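(* Let $L$ be a finite relational language of unary and binary symbols and $\mathbf{K}$ a countably infinite irreducible $L$-structure such that every countable $L$-structure $\mathbf{A}$ has a completion to $\mathbf{K}$ provided every induced cycle in $\mathbf{A}$ has a completion to $\mathbf{K}$ and every irreducible substructure of $\mathbf{A}$ of size at most $2$ embeds into $\mathbf{K}$. Let $\Sigma$ and $\mathbf{G}$ be as in the context. Then for every finite $k\ge1$ and every colouring of the $k$-element subsets of $G$ with finitely many colours, there exists an embedding $f\colon\mathbf{G}\to\mathbf{G}$ such that the colour of every $k$-element subset $S$ of $f(G)$ depends only on $\tau(S)$, where $\tau(S)=\tau(f^{-1}[S])$.
   Context: Basic notions: homomorphisms preserve relations; embeddings are injective homomorphisms reflecting relations; substructures are induced. Distinct vertices are adjacent if some relation contains $(u,v)$ or $(v,u)$; a structure is irreducible if all pairs of distinct vertices are adjacent. A cycle is a sequence of $\ell\ge3$ distinct vertices with consecutive ones (cyclically) adjacent; it is induced if no other pairs are adjacent. A homomorphism-embedding is a homomorphism whose restriction to every irreducible substructure is an embedding; a completion of $\mathbf{A}$ to $\mathbf{B}$ is an injective homomorphism-embedding into an irreducible $\mathbf{B}$. $\Sigma$ is the finite set of all $L$-structures with vertex set $\{0,1\}$ that embed into $\mathbf{K}$; $\Sigma^*$ denotes the set of finite words over $\Sigma$. For a word $W$, $|W|$ is its length and $\mathbf{W}_j$ (or $W_j$) the letter at index $j$, indices starting at $0$. $\triangle(\mathbf{A},\mathbf{B},\mathbf{C})$ for $\mathbf{A},\mathbf{B},\mathbf{C}\in\Sigma$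 is the unique $L$-structure $\mathbf{D}$ on $\{u,v,w\}$ (if it exists) with $0\mapsto u,1\mapsto v$ an embedding of $\mathbf{A}$, $0\mapsto v,1\mapsto w$ an embedding of $\mathbf{B}$, and $0\mapsto u,1\mapsto w$ an embedding of $\mathbf{C}$ into $\mathbf{D}$; otherwise undefined. $\mathbf{G}$ has vertex set $G$ consisting of all words $W\in\Sigma^*$ of length $\ge1$ such that the substructures induced on $\{1\}$ by all letters $\mathbf{W}_i$ are pairwise isomorphic; for $U,V\in G$ with $|U|<|V|$ such that for each $0\le i<|U|$, $\triangle(\mathbf{U}_i,\mathbf{V}_{|U|},\mathbf{V}_i)$ is defined and embeds into $\mathbf{K}$, the relations on $\{U,V\}$ make $0\mapsto U,1\mapsto V$ an embedding $\mathbf{V}_{|U|}\to\mathbf{G}$; no other tuples are in the relations. Parameter words over the empty alphabet: for $k\in\omega\cup\{\omega\}$, a $k$-parameter word is a (possibly infinite) string over the symbols $\{\lambda_i: 0\le i<k\}$ containing every $\lambda_i$, $i<k$, and such that for $1\le j<k$ the first occurrence of $\lambda_j$ comes after the first occurrence of $\lambda_{j-1}$. If $W$ is an $n$-parameter word and $U$ is a word (or parameter word) of length $k\le n$, $W(U)$ is obtained from $W$ by replacing each occurrence of $\lambda_i$ ($i<k$) by $U_i$ and truncating just before the first occurrence of $\lambda_k$ in $W$ (no truncation if $k=n$); $W(S')=\{W(U):U\in S'\}$. For finite $d>0$ and finite $S\subseteq\Sigma^*$, a finite $d$-parameter word $W$ (of length at least $d$) is a $d$-parametric envelope of $S$ if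 there is $S'\subseteq\Sigma^*$ with $W(S')=S$; $S'$ is the embedding type $\tau_W(S)$. A $d$-parametric envelope with minimal possible $d$ is a minimal envelope, and $\tau(S)$ denotes $\tau_W(S)$ for a minimal envelope $W$ of $S$ (this is known to be independent of the choice of minimal envelope, and every finite $S$ has an envelope). *)

theory Defs
  imports "HOL-Library.Countable_Set"
begin

record 'l language =
  symbols :: "'l set"
  arity :: "'l \<Rightarrow> nat"

record ('v, 'l) rstruct =
  verts :: "'v set"
  rel :: "'l \<Rightarrow> 'v list set"

text \<open>Tuples are lists. Interpretations of symbols outside the language are required to be
  empty, so that two structures are equal iff they have the same vertices and the same relations.\<close>

definition is_structure :: "'l language \<Rightarrow> ('v, 'l) rstruct \<Rightarrow> bool" where
  "is_structure L A \<longleftrightarrow>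
     (\<forall>R\<in>symbols L. \<forall>xs\<in>rel A R. length xs = arity L R \<and> set xs \<subseteq> verts A) \<and>
     (\<forall>R. R \<notin> symbols L \<longrightarrow> rel A R = {})"

definition homomorphism ::
    "'l language \<Rightarrow> ('v, 'l) rstruct \<Rightarrow> ('w, 'l) rstruct \<Rightarrow> ('v \<Rightarrow> 'w) \<Rightarrow> bool" where
  "homomorphism L A B f \<longleftrightarrow>
     f ` verts A \<subseteq> verts B \<and> (\<forall>R\<in>symbols L. \<forall>xs\<in>rel A R. map f xs \<in> rel B R)"

definition embedding ::
    "'l language \<Rightarrow> ('v, 'l) rstruct \<Rightarrow> ('w, 'l) rstruct \<Rightarrow> ('v \<Rightarrow> 'w) \<Rightarrow> bool" where
  "embedding L A B f \<longleftrightarrow>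
     homomorphism L A B f \<and> inj_on f (verts A) \<and>
     (\<forall>R\<in>symbols L. \<forall>xs. set xs \<subseteq> verts A \<and> length xs = arity L R \<and> map f xs \<in> rel B R
        \<longrightarrow> xs \<in> rel A R)"

definition embeds :: "'l language \<Rightarrow> ('v, 'l) rstruct \<Rightarrow> ('w, 'l) rstruct \<Rightarrow> bool" where
  "embeds L A B \<longleftrightarrow> (\<exists>f. embedding L A B f)"

definition isomorphic :: "'l language \<Rightarrow> ('v, 'l) rstruct \<Rightarrow> ('w, 'l) rstruct \<Rightarrow> bool" where
  "isomorphic L A B \<longleftrightarrow> (\<exists>f. embedding L A B f \<and> f ` verts A = verts B)"

definition induced :: "('v, 'l) rstruct \<Rightarrow> 'v set \<Rightarrow> ('v, 'l) rstruct" where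
  "induced A X = \<lparr>verts = X, rel = (\<lambda>R. {xs \<in> rel A R. set xs \<subseteq> X})\<rparr>"

definition adjacent :: "'l language \<Rightarrow> ('v, 'l) rstruct \<Rightarrow> 'v \<Rightarrow> 'v \<Rightarrow> bool" where
  "adjacent L A u v \<longleftrightarrow>
     u \<noteq> v \<and> (\<exists>R\<in>symbols L. [u, v] \<in> rel A R \<or> [v, u] \<in> rel A R)"

definition irreducible_struct :: "'l language \<Rightarrow> ('v, 'l) rstruct \<Rightarrow> bool" where
  "irreducible_struct L A \<longleftrightarrow>
     (\<forall>u\<in>verts A. \<forall>v\<in>verts A. u \<noteq> v \<longrightarrow> adjacent L A u v)"

definition cycle :: "'l language \<Rightarrow> ('v, 'l) rstruct \<Rightarrow> 'v list \<Rightarrow> bool" where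
  "cycle L A c \<longleftrightarrow>
     length c \<ge> 3 \<and> distinct c \<and> set c \<subseteq> verts A \<and>
     (\<forall>i<length c. adjacent L A (c ! i) (c ! (Suc i mod length c)))"

definition induced_cycle :: "'l language \<Rightarrow> ('v, 'l) rstruct \<Rightarrow> 'v list \<Rightarrow> bool" where
  "induced_cycle L A c \<longleftrightarrow>
     cycle L A c \<and>
     (\<forall>i<length c. \<forall>j<length c. adjacent L A (c ! i) (c ! j) \<longrightarrow>
        j = Suc i mod length c \<or> i = Suc j mod length c)"

definition homomorphism_embedding ::
    "'l language \<Rightarrow> ('v, 'l) rstruct \<Rightarrow> ('w, 'l) rstruct \<Rightarrow> ('v \<Rightarrow> 'w) \<Rightarrow> bool" where
  "homomorphism_embedding L A B f \<longleftrightarrow>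
     homomorphism L A B f \<and>
     (\<forall>X\<subseteq>verts A. irreducible_struct L (induced A X) \<longrightarrow> embedding L (induced A X) B f)"

definition has_completion :: "'l language \<Rightarrow> ('v, 'l) rstruct \<Rightarrow> ('w, 'l) rstruct \<Rightarrow> bool" where
  "has_completion L A B \<longleftrightarrow>
     irreducible_struct L B \<and> (\<exists>f. homomorphism_embedding L A B f \<and> inj_on f (verts A))"

text \<open>The completion property of \<open>K\<close>. HOL cannot quantify over vertex types inside a formula;
  every countable structure is isomorphic to one whose vertices are natural numbers, so the
  quantifier ranges over structures on arbitrary (finite or infinite) subsets of \<^typ>\<open>nat\<close>.\<close>

definition cycle_completion_property :: "'l language \<Rightarrow> ('v, 'l) rstruct \<Rightarrow> bool" where
  "cycle_completion_property L K \<longleftrightarrow>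
     (\<forall>A :: (nat, 'l) rstruct. is_structure L A \<longrightarrow>
        (\<forall>c. induced_cycle L A c \<longrightarrow> has_completion L (induced A (set c)) K) \<longrightarrow>
        (\<forall>X\<subseteq>verts A. finite X \<and> card X \<le> 2 \<and> irreducible_struct L (induced A X) \<longrightarrow>
           embeds L (induced A X) K) \<longrightarrow>
        has_completion L A K)"

definition alphabet :: "'l language \<Rightarrow> ('v, 'l) rstruct \<Rightarrow> (nat, 'l) rstruct set" where
  "alphabet L K = {A. is_structure L A \<and> verts A = {0, 1} \<and> embeds L A K}"

definition pair_map :: "'v \<Rightarrow> 'v \<Rightarrow> nat \<Rightarrow> 'v" where
  "pair_map u v i = (if i = 0 then u else v)"

definition is_triangle ::
    "'l language \<Rightarrow> (nat, 'l) rstruct \<Rightarrow> (nat, 'l) rstruct \<Rightarrow> (nat, 'l) rstruct \<Rightarrow>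
     (nat, 'l) rstruct \<Rightarrow> bool" where
  "is_triangle L A B C D \<longleftrightarrow>
     is_structure L D \<and> verts D = {0, 1, 2} \<and>
     embedding L A D (pair_map 0 1) \<and>
     embedding L B D (pair_map 1 2) \<and>
     embedding L C D (pair_map 0 2)"

definition triangle ::
    "'l language \<Rightarrow> (nat, 'l) rstruct \<Rightarrow> (nat, 'l) rstruct \<Rightarrow> (nat, 'l) rstruct \<Rightarrow>
     (nat, 'l) rstruct option" where
  "triangle L A B C =
     (if \<exists>!D. is_triangle L A B C D then Some (THE D. is_triangle L A B C D) else None)"

type_synonym 'l word = "(nat, 'l) rstruct list"

definition G_verts :: "'l language \<Rightarrow> ('v, 'l) rstruct \<Rightarrow> 'l word set" where
  "G_verts L K =
     {W \<in> lists (alphabet L K). length W \<ge> 1 \<and>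
        (\<forall>i<length W. \<forall>j<length W. isomorphic L (induced (W ! i) {1}) (induced (W ! j) {1}))}"

definition G_related :: "'l language \<Rightarrow> ('v, 'l) rstruct \<Rightarrow> 'l word \<Rightarrow> 'l word \<Rightarrow> bool" where
  "G_related L K U V \<longleftrightarrow>
     U \<in> G_verts L K \<and> V \<in> G_verts L K \<and> length U < length V \<and>
     (\<forall>i<length U. \<exists>D. triangle L (U ! i) (V ! length U) (V ! i) = Some D \<and> embeds L D K)"

text \<open>If \<open>K\<close> is infinite and irreducible and has the completion property, then every vertex lies
  in a related pair and any two related pairs agree on a common vertex, so that the relations
  below make \<open>pair_map U V\<close> an embedding of \<open>V ! length U\<close> for each related pair. In particular
  they then contain the unary relations and loops.\<close>

definition G :: "'l language \<Rightarrow> ('v, 'l) rstruct \<Rightarrow> ('l word, 'l) rstruct" where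
  "G L K =
     \<lparr>verts = G_verts L K,
      rel = (\<lambda>R. {map (pair_map U V) xs | U V xs.
                    G_related L K U V \<and> xs \<in> rel (V ! length U) R})\<rparr>"

text \<open>A finite parameter word over the empty alphabet is the list of the indices of its
  parameters.\<close>

definition first_occ :: "nat list \<Rightarrow> nat \<Rightarrow> nat" where
  "first_occ W i = length (takeWhile (\<lambda>x. x \<noteq> i) W)"

definition parameter_word :: "nat \<Rightarrow> nat list \<Rightarrow> bool" where
  "parameter_word d W \<longleftrightarrow>
     set W = {..<d} \<and> (\<forall>j. 1 \<le> j \<and> j < d \<longrightarrow> first_occ W (j - 1) < first_occ W j)"

text \<open>The word \<open>W(U)\<close>. This is meaningful only if \<open>U\<close> is at most as long as the number of
  parameters of \<open>W\<close>. If \<open>U\<close> has exactly that length, the parameter with index \<open>length U\<close> does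
  not occur in \<open>W\<close> and nothing is truncated.\<close>

definition param_subst :: "nat list \<Rightarrow> 'a list \<Rightarrow> 'a list" where
  "param_subst W U = map (\<lambda>i. U ! i) (takeWhile (\<lambda>x. x \<noteq> length U) W)"

definition is_embedding_type ::
    "'a set \<Rightarrow> nat \<Rightarrow> nat list \<Rightarrow> 'a list set \<Rightarrow> 'a list set \<Rightarrow> bool" where
  "is_embedding_type \<Sigma> d W S S' \<longleftrightarrow>
     S' \<subseteq> lists \<Sigma> \<and> (\<forall>U\<in>S'. length U \<le> d) \<and> param_subst W ` S' = S"

definition envelope :: "'a set \<Rightarrow> nat \<Rightarrow> nat list \<Rightarrow> 'a list set \<Rightarrow> bool" where
  "envelope \<Sigma> d W S \<longleftrightarrow>
     d > 0 \<and> parameter_word d W \<and> length W \<ge> d \<and> (\<exists>S'. is_embedding_type \<Sigma> d W S S')"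

definition embedding_type :: "'a set \<Rightarrow> nat \<Rightarrow> nat list \<Rightarrow> 'a list set \<Rightarrow> 'a list set" where
  "embedding_type \<Sigma> d W S = (THE S'. is_embedding_type \<Sigma> d W S S')"

definition minimal_envelope :: "'a set \<Rightarrow> nat \<Rightarrow> nat list \<Rightarrow> 'a list set \<Rightarrow> bool" where
  "minimal_envelope \<Sigma> d W S \<longleftrightarrow>
     envelope \<Sigma> d W S \<and> (\<forall>d' W'. envelope \<Sigma> d' W' S \<longrightarrow> d \<le> d')"

text \<open>For finite \<open>S\<close> an envelope exists and all minimal envelopes give the same embedding type.\<close>

definition tau :: "'a set \<Rightarrow> 'a list set \<Rightarrow> 'a list set" where
  "tau \<Sigma> S =
     (SOME T. \<exists>d W. minimal_envelope \<Sigma> d W S \<and> T = embedding_type \<Sigma> d W S)"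

end

(* For an infinite parameter word W, the map X |-> W(X) is an embedding of G: whether U and V are
   related, and how, depends only on triples of letters U_i, V_i, V_|U|, and substitution repeats
   exactly these triples. It also preserves embedding types, because a set S determines the positions
   where the parameters of a minimal envelope must occur first, and W moves these positions
   monotonically. A set S of type T is E(T) for a parameter word E, the number of parameters of E is
   determined by T and bounded in terms of k, and W(S) = (W(E))(T). So the theorem reduces to finding
   W such that, for each small d, W(E) has the same colour for all d-parameter words E, where the
   colour of E records the colours of E(T) for all T. This is proved by induction on d: an infinite
   fusion makes the colour of W(E d Z) independent of Z, and each fusion step is the Carlson-Simpson
   theorem, proved with idempotent ultrafilters on words. *)
theory Submission
  imports Defs "HOL-Analysis.T1_Spaces"
begin

section \<open>Ultrafilters on words\<close>

text \<open>Truncation shapes the combinatorics. A word \<open>V(Y)\<close> is cut just before a new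
  parameter, so a sequence of variable words can serve as a parameter word only if every block
  begins with its own variable; the ultrafilter on variable words is therefore built on words of
  this shape. In the induction on the number of parameters, the tail of a word has to be made
  irrelevant for all initial parts \<open>E\<close> of a given length at once. This works because
  the positions of \<open>E\<close>, rather than its entries, are taken as the letters of a finite
  alphabet. The bound on the number of parameters comes from reading a \<open>k\<close>-set position
  by position: a minimal envelope starts a parameter only where some word ends or where a column
  appears that differs from all earlier ones. This gives at most
  \<open>k + Suc (card \<Sigma>) ^ k\<close> parameters. A vertex of \<open>G\<close> carries the
  unary relations and loops prescribed by its letters only through membership in some related pair.
  Producing such a pair is where infinity, irreducibility and the completion property of
  \<open>K\<close> enter.\<close>

text \<open>Ultrafilters are indicator functions on the power set, hence points of a compact power of a
  two-point space; on words they form a right topological semigroup under \<open>conv\<close>.\<close>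

definition ultra :: "('a set \<Rightarrow> bool) \<Rightarrow> bool" where
  "ultra p \<longleftrightarrow> (\<forall>A B. p (A \<inter> B) = (p A \<and> p B)) \<and> (\<forall>A. p (- A) = (\<not> p A))"

lemma ultra_Int: "ultra p \<Longrightarrow> p (A \<inter> B) = (p A \<and> p B)"
  by (simp add: ultra_def)

lemma ultra_Compl: "ultra p \<Longrightarrow> p (- A) = (\<not> p A)"
  by (simp add: ultra_def)

lemma ultra_mono: "ultra p \<Longrightarrow> p A \<Longrightarrow> A \<subseteq> B \<Longrightarrow> p B"
  by (metis inf.absorb_iff1 ultra_Int)

lemma ultra_empty: "ultra p \<Longrightarrow> \<not> p {}"
  by (metis Int_empty_left ultra_Compl ultra_Int)

lemma ultra_UNIV: "ultra p \<Longrightarrow> p UNIV"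
  by (metis Compl_UNIV_eq ultra_Compl ultra_empty)

lemma ultra_nonempty: "ultra p \<Longrightarrow> p A \<Longrightarrow> A \<noteq> {}"
  by (metis ultra_empty)

lemma ultra_Inter:
  assumes "finite I" "ultra p" "\<And>i. i \<in> I \<Longrightarrow> p (A i)"
  shows "p (\<Inter>i\<in>I. A i)"
  using assms by (induction rule: finite_induct) (auto simp: ultra_UNIV ultra_Int)

definition conv :: "('a list set \<Rightarrow> bool) \<Rightarrow> ('a list set \<Rightarrow> bool) \<Rightarrow> 'a list set \<Rightarrow> bool" where
  "conv p q = (\<lambda>A. p {s. q {t. s @ t \<in> A}})"

definition map_ultra :: "('a \<Rightarrow> 'b) \<Rightarrow> ('a set \<Rightarrow> bool) \<Rightarrow> 'b set \<Rightarrow> bool" where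
  "map_ultra f p = (\<lambda>A. p (f -` A))"

lemma ultra_map: "ultra p \<Longrightarrow> ultra (map_ultra f p)"
  by (auto simp: ultra_def map_ultra_def vimage_Compl)

lemma ultra_conv:
  assumes "ultra p" "ultra q"
  shows "ultra (conv p q)"
proof -
  have 1: "{s. q {t. s @ t \<in> A \<inter> B}} = {s. q {t. s @ t \<in> A}} \<inter> {s. q {t. s @ t \<in> B}}" for A B
  proof -
    have "{t. s @ t \<in> A \<inter> B} = {t. s @ t \<in> A} \<inter> {t. s @ t \<in> B}" for s by auto
    then show ?thesis by (auto simp: ultra_Int[OF assms(2)])
  qed
  have 2: "{s. q {t. s @ t \<in> - A}} = - {s. q {t. s @ t \<in> A}}" for A
  proof -
    have "{t. s @ t \<in> - A} = - {t. s @ t \<in> A}" for s by auto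
    then show ?thesis by (auto simp: ultra_Compl[OF assms(2)])
  qed
  show ?thesis
    unfolding ultra_def conv_def 1 2
    using assms(1) by (simp add: ultra_Int ultra_Compl)
qed

lemma conv_assoc: "conv (conv p q) r = conv p (conv q r)"
  by (simp add: conv_def fun_eq_iff)

lemma map_ultra_conv:
  assumes "\<And>s t. f (s @ t) = f s @ f t"
  shows "map_ultra f (conv p q) = conv (map_ultra f p) (map_ultra f q)"
  by (simp add: map_ultra_def conv_def fun_eq_iff vimage_def assms)

section \<open>The compact Hausdorff space of ultrafilters and its idempotents\<close>

abbreviation cantor :: "('a set \<Rightarrow> bool) topology" where
  "cantor \<equiv> product_topology (\<lambda>_. discrete_topology UNIV) UNIV"

lemma compact_cantor: "compact_space cantor"
  by (simp add: compact_space_product_topology compact_space_discrete_topology)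

lemma Hausdorff_cantor: "Hausdorff_space cantor"
  by (simp add: Hausdorff_space_product_topology)

lemma closedin_coordinate:
  "closedin cantor {p. p A}" "closedin cantor {p. \<not> p A}"
proof -
  have c: "continuous_map cantor (discrete_topology UNIV) (\<lambda>p. p A)"
    by (intro continuous_map_product_projection) simp
  show "closedin cantor {p. p A}" "closedin cantor {p. \<not> p A}"
    using closedin_continuous_map_preimage[OF c, of "{True}"]
      closedin_continuous_map_preimage[OF c, of "{False}"] by simp_all
qed

text \<open>Each instance of the two axioms constrains at most three coordinates, so it is a Boolean
  combination of coordinate conditions, and these are closed together with their
  complements.\<close>

lemma closedin_ultra: "closedin cantor {p :: 'a set \<Rightarrow> bool. ultra p}"
proof -
  have 1: "closedin cantor {p. p (A \<inter> B) = (p A \<and> p B)}" for A B :: "'a set"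
  proof -
    have "{p. p (A \<inter> B) = (p A \<and> p B)} =
        ({p. p (A \<inter> B)} \<inter> ({p. p A} \<inter> {p. p B})) \<union>
        ({p. \<not> p (A \<inter> B)} \<inter> ({p. \<not> p A} \<union> {p. \<not> p B}))"
      by auto
    then show ?thesis
      by (simp only: closedin_Un closedin_Int closedin_coordinate)
  qed
  have 2: "closedin cantor {p. p (- A) = (\<not> p A)}" for A :: "'a set"
  proof -
    have "{p. p (- A) = (\<not> p A)} =
        ({p. p (- A)} \<inter> {p. \<not> p A}) \<union> ({p. \<not> p (- A)} \<inter> {p. p A})"
      by auto
    then show ?thesis
      by (simp only: closedin_Un closedin_Int closedin_coordinate)
  qed
  have "{p :: 'a set \<Rightarrow> bool. ultra p} =
      (\<Inter>A. \<Inter>B. {p. p (A \<inter> B) = (p A \<and> p B)}) \<inter> (\<Inter>A. {p. p (- A) = (\<not> p A)})"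
    by (auto simp: ultra_def)
  moreover have "closedin cantor
      ((\<Inter>A. \<Inter>B. {p :: 'a set \<Rightarrow> bool. p (A \<inter> B) = (p A \<and> p B)}) \<inter> (\<Inter>A. {p. p (- A) = (\<not> p A)}))"
    by (intro closedin_Int closedin_INT 1 2) auto
  ultimately show ?thesis by simp
qed

text \<open>For fixed \<open>q\<close>, the coordinate of \<open>conv p q\<close> at
  \<open>A\<close> is the coordinate of \<open>p\<close> at a set that depends on \<open>q\<close>
  and \<open>A\<close> only.\<close>

lemma continuous_conv_left: "continuous_map cantor cantor (\<lambda>p. conv p q)"
  unfolding continuous_map_componentwise_UNIV conv_def
  by (auto intro!: continuous_map_product_projection)

lemma continuous_map_ultra: "continuous_map cantor cantor (map_ultra f)"
  unfolding continuous_map_componentwise_UNIV map_ultra_def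
  by (auto intro!: continuous_map_product_projection)

lemma closedin_conv_image:
  assumes "closedin cantor T"
  shows "closedin cantor ((\<lambda>p. conv p q) ` T)"
  by (rule compactin_imp_closedin[OF Hausdorff_cantor
        image_compactin[OF closedin_compact_space[OF compact_cantor assms] continuous_conv_left]])

text \<open>Compactness keeps the intersection of a chain of nonempty closed sets nonempty. The
  property \<open>Q\<close> will be that of being a subsemigroup or a left ideal; both pass to
  arbitrary intersections.\<close>

lemma minimal_closed_exists:
  fixes Q :: "('a set \<Rightarrow> bool) set \<Rightarrow> bool"
  assumes T: "closedin cantor T" "T \<noteq> {}" "Q T"
    and chain: "\<And>\<C>. \<C> \<noteq> {} \<Longrightarrow> (\<And>X. X \<in> \<C> \<Longrightarrow> Q X) \<Longrightarrow> Q (\<Inter>\<C>)"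
  obtains M where "M \<subseteq> T" "closedin cantor M" "M \<noteq> {}" "Q M"
    "\<And>X. X \<subseteq> M \<Longrightarrow> closedin cantor X \<Longrightarrow> X \<noteq> {} \<Longrightarrow> Q X \<Longrightarrow> X = M"
proof -
  define F where "F = {X. X \<subseteq> T \<and> closedin cantor X \<and> X \<noteq> {} \<and> Q X}"
  \<comment> \<open>Zorn's lemma is available for maximal elements, so it is applied to
    complements.\<close>
  have "\<exists>M\<in>uminus ` F. \<forall>X\<in>uminus ` F. M \<subseteq> X \<longrightarrow> X = M"
  proof (rule subset_Zorn_nonempty)
    show "uminus ` F \<noteq> {}" using T by (auto simp: F_def)
  next
    fix \<C> :: "('a set \<Rightarrow> bool) set set"
    assume ne: "\<C> \<noteq> {}" and ch: "subset.chain (uminus ` F) \<C>"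
    define \<D> where "\<D> = uminus ` \<C>"
    have CD: "\<Union>\<C> = - \<Inter>\<D>" unfolding \<D>_def by auto
    have DF: "\<D> \<subseteq> F" using ch unfolding \<D>_def subset_chain_def by auto
    have ne': "\<D> \<noteq> {}" using ne by (simp add: \<D>_def)
    have lin: "X \<subseteq> Y \<or> Y \<subseteq> X" if "X \<in> \<D>" "Y \<in> \<D>" for X Y
      using ch that unfolding \<D>_def subset_chain_def by blast
    \<comment> \<open>A finite subfamily of a chain has a least member, which yields the finite
      intersection property.\<close>
    have fin: "\<exists>X\<in>\<D>. X \<subseteq> \<Inter>\<F>" if "finite \<F>" "\<F> \<subseteq> \<D>" for \<F>
      using that
    proof (induction rule: finite_induct)
      case empty then show ?case using ne' by auto
    next
      case (insert A \<F>)
      have "\<exists>X\<in>\<D>. X \<subseteq> \<Inter>\<F>" by (rule insert.IH) (use insert.prems in simp)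
      then obtain X where X: "X \<in> \<D>" "X \<subseteq> \<Inter>\<F>" ..
      have A: "A \<in> \<D>" using insert.prems by simp
      show ?case
      proof (cases "X \<subseteq> A")
        case True
        then have "X \<subseteq> \<Inter>(insert A \<F>)" using X(2) by simp
        then show ?thesis using X(1) ..
      next
        case False
        then have "A \<subseteq> X" using lin[OF X(1) A] by simp
        then have "A \<subseteq> \<Inter>(insert A \<F>)" using X(2) by simp
        then show ?thesis using A ..
      qed
    qed
    have "\<Inter>\<D> \<noteq> {}"
    proof (rule compact_space_fip[THEN iffD1, OF compact_cantor, rule_format])
      show "(\<forall>C\<in>\<D>. closedin cantor C) \<and> (\<forall>\<F>. finite \<F> \<and> \<F> \<subseteq> \<D> \<longrightarrow> \<Inter>\<F> \<noteq> {})"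
      proof (intro conjI ballI allI impI)
        fix C assume "C \<in> \<D>" then show "closedin cantor C" using DF F_def by auto
      next
        fix \<F> assume "finite \<F> \<and> \<F> \<subseteq> \<D>"
        then obtain X where "X \<in> \<D>" "X \<subseteq> \<Inter>\<F>" using fin by metis
        moreover have "X \<noteq> {}" using \<open>X \<in> \<D>\<close> DF F_def by auto
        ultimately show "\<Inter>\<F> \<noteq> {}" by auto
      qed
    qed
    moreover have "closedin cantor (\<Inter>\<D>)" using DF ne' by (auto simp: F_def)
    moreover have "\<Inter>\<D> \<subseteq> T" using DF ne' by (auto simp: F_def)
    moreover have "Q (\<Inter>\<D>)" using DF ne' by (intro chain) (auto simp: F_def)
    ultimately have "\<Inter>\<D> \<in> F" by (simp add: F_def)
    then show "\<Union>\<C> \<in> uminus ` F" using CD by auto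
  qed
  then obtain M where M: "M \<in> F" "\<And>X. X \<in> F \<Longrightarrow> - M \<subseteq> - X \<Longrightarrow> - X = - M" by auto
  show ?thesis
  proof (rule that[of M])
    fix X assume "X \<subseteq> M" "closedin cantor X" "X \<noteq> {}" "Q X"
    then show "X = M" using M by (auto simp: F_def)
  qed (use M in \<open>auto simp: F_def\<close>)
qed

theorem Ellis_idempotent:
  fixes T :: "('a list set \<Rightarrow> bool) set"
  assumes "closedin cantor T" "T \<noteq> {}" "\<And>p q. p \<in> T \<Longrightarrow> q \<in> T \<Longrightarrow> conv p q \<in> T"
  obtains e where "e \<in> T" "conv e e = e"
proof -
  define Q where "Q = (\<lambda>X :: ('a list set \<Rightarrow> bool) set. \<forall>p\<in>X. \<forall>q\<in>X. conv p q \<in> X)"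
  obtain M where M: "M \<subseteq> T" "closedin cantor M" "M \<noteq> {}" "Q M"
    "\<And>X. X \<subseteq> M \<Longrightarrow> closedin cantor X \<Longrightarrow> X \<noteq> {} \<Longrightarrow> Q X \<Longrightarrow> X = M"
    by (rule minimal_closed_exists[of T Q]) (use assms in \<open>auto simp: Q_def\<close>)
  obtain r where r: "r \<in> M" using M by auto
  \<comment> \<open>The right translate of \<open>M\<close> by \<open>r\<close> is again a closed
    subsemigroup inside \<open>M\<close>.\<close>
  have "(\<lambda>p. conv p r) ` M = M"
  proof (rule M(5))
    show "(\<lambda>p. conv p r) ` M \<subseteq> M" using M(4) r by (auto simp: Q_def)
    show "Q ((\<lambda>p. conv p r) ` M)"
      unfolding Q_def using M(4) r by (auto simp: Q_def conv_assoc image_iff) (metis conv_assoc)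
  qed (use M(3) closedin_conv_image[OF M(2)] in auto)
  then have "r \<in> (\<lambda>p. conv p r) ` M" using r by simp
  then obtain p where p: "p \<in> M" "conv p r = r" by (metis imageE)
  \<comment> \<open>The elements fixing \<open>r\<close> from the left also form a closed
    subsemigroup, nonempty by the choice of \<open>p\<close>. By minimality \<open>r\<close> itself
    is one of them.\<close>
  have "{t \<in> M. conv t r = r} = M"
  proof (rule M(5))
    have "closedin cantor {t \<in> topspace cantor. conv t r \<in> {r}}"
      by (rule closedin_continuous_map_preimage[OF continuous_conv_left])
        (auto intro: closedin_Hausdorff_singleton Hausdorff_cantor)
    then have "closedin cantor (M \<inter> {t. conv t r = r})" using M(2) by (auto intro!: closedin_Int)
    then show "closedin cantor {t \<in> M. conv t r = r}" by (simp add: Int_def)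
    show "Q {t \<in> M. conv t r = r}"
      using M(4) by (auto simp: Q_def conv_assoc)
  qed (use p in auto)
  then show ?thesis using that r M(1) by blast
qed

section \<open>Ultrafilters on variable words\<close>

text \<open>The numbers below \<open>N\<close> are the letters and \<open>N\<close> itself is the
  variable, so that a variable word is an ordinary list over \<open>{..N}\<close>.\<close>

definition subst_letter :: "nat \<Rightarrow> nat \<Rightarrow> nat list \<Rightarrow> nat list" where
  "subst_letter N a = map (\<lambda>i. if i = N then a else i)"

lemma subst_letter_append [simp]: "subst_letter N a (u @ v) = subst_letter N a u @ subst_letter N a v"
  by (simp add: subst_letter_def)

lemma conv_lists:
  assumes "ultra p" "ultra q" "p (lists A)" "q (lists A)"
  shows "conv p q (lists A)"
  unfolding conv_def
  by (rule ultra_mono[OF assms(1,3)]) (auto intro: ultra_mono[OF assms(2,4)])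

text \<open>The substitution instances of \<open>r\<close> are idempotents of one minimal left ideal of the semigroup
  of ultrafilters on words; \<open>conv e f = e\<close> for any two such idempotents.\<close>

proposition variable_word_ultrafilter:
  fixes N :: nat
  assumes "N > 0"
  obtains r where "ultra r" "r {N # w | w. w \<in> lists {..N}}"
    "\<And>a b. a < N \<Longrightarrow> b < N \<Longrightarrow> conv (map_ultra (subst_letter N a) r) (map_ultra (subst_letter N b) r) =
      map_ultra (subst_letter N a) r"
proof -
  define S where "S = {p. ultra p \<and> p (lists {..<N})}"
  define W where "W = {N # w | w. w \<in> lists {..N}}"
  have S_conv: "conv p q \<in> S" if "p \<in> S" "q \<in> S" for p q
    using that by (auto simp: S_def ultra_conv conv_lists)
  have clS: "closedin cantor S"
    using closedin_Int[OF closedin_ultra closedin_coordinate(1)[of "lists {..<N}"]]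
    by (simp add: S_def Int_def)
  \<comment> \<open>Here \<open>Q\<close> says that a set is a left ideal for \<open>S\<close>. The
    principal ultrafilter at the empty word shows that \<open>S\<close> is nonempty.\<close>
  define Q where "Q = (\<lambda>X. \<forall>p\<in>S. \<forall>q\<in>X. conv p q \<in> X)"
  have "(\<lambda>A. [] \<in> A) \<in> S" by (auto simp: S_def ultra_def)
  then obtain I where I: "I \<subseteq> S" "closedin cantor I" "I \<noteq> {}" "Q I"
    "\<And>X. X \<subseteq> I \<Longrightarrow> closedin cantor X \<Longrightarrow> X \<noteq> {} \<Longrightarrow> Q X \<Longrightarrow> X = I"
    by (rule_tac minimal_closed_exists[of S Q]) (use clS S_conv in \<open>auto simp: Q_def\<close>)
  \<comment> \<open>\<open>S f\<close> is a closed left ideal contained in \<open>I\<close>, hence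
    equal to \<open>I\<close>. So \<open>e = q f\<close> for some \<open>q\<close>, and multiplying
    by the idempotent \<open>f\<close> on the right changes nothing.\<close>
  have absorb: "conv e f = e" if e: "e \<in> I" and f: "f \<in> I" "conv f f = f" for e f
  proof -
    have "(\<lambda>p. conv p f) ` S = I"
    proof (rule I(5))
      show "(\<lambda>p. conv p f) ` S \<subseteq> I" using I(4) f by (auto simp: Q_def)
      show "Q ((\<lambda>p. conv p f) ` S)"
        unfolding Q_def by (auto simp: image_iff) (metis conv_assoc S_conv)
      show "(\<lambda>p. conv p f) ` S \<noteq> {}" using I(1,3) by auto
    qed (use closedin_conv_image[OF clS] in auto)
    then have "e \<in> (\<lambda>p. conv p f) ` S" using e by simp
    then obtain q where "e = conv q f" by blast
    then show ?thesis by (simp add: conv_assoc f(2))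
  qed
  \<comment> \<open>The ultrafilters on words beginning with the variable all of whose letter
    instances lie in \<open>I\<close>. They form a closed semigroup, and an idempotent of it is the
    required \<open>r\<close>.\<close>
  define T where "T = {r. ultra r \<and> r W \<and> (\<forall>a<N. map_ultra (subst_letter N a) r \<in> I)}"
  have "closedin cantor T"
  proof -
    have 1: "closedin cantor {r. map_ultra (subst_letter N a) r \<in> I}" for a
      using closedin_continuous_map_preimage[OF continuous_map_ultra I(2), of "subst_letter N a"] by simp
    have "T = ({p. ultra p} \<inter> {p. p W}) \<inter> (\<Inter>a\<in>{..<N}. {r. map_ultra (subst_letter N a) r \<in> I})"
      by (auto simp: T_def)
    moreover have "closedin cantor (({p. ultra p} \<inter> {p. p W}) \<inter> (\<Inter>a\<in>{..<N}. {r. map_ultra (subst_letter N a) r \<in> I}))"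
      using assms by (intro closedin_Int closedin_INT 1 closedin_ultra closedin_coordinate) auto
    ultimately show ?thesis by simp
  qed
  moreover have "T \<noteq> {}"
  proof -
    obtain q where q: "q \<in> I" using I by auto
    then have qS: "ultra q" "q (lists {..<N})" using I(1) by (auto simp: S_def)
    \<comment> \<open>Prepending the variable to \<open>q\<close> works: on words over the letters,
      replacing the variable by \<open>a\<close> amounts to multiplying \<open>q\<close> from the
      left by the principal ultrafilter at \<open>[a]\<close>, which keeps it in the left
      ideal.\<close>
    let ?r = "map_ultra ((#) N) q"
    have "map_ultra (subst_letter N a) ?r \<in> I" if "a < N" for a
    proof -
      have pS: "(\<lambda>A. [a] \<in> A) \<in> S" using that by (auto simp: S_def ultra_def)
      have "map_ultra (subst_letter N a) ?r = conv (\<lambda>A. [a] \<in> A) q"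
      proof
        fix A
        have eq: "lists {..<N} \<inter> {w. subst_letter N a (N # w) \<in> A} = lists {..<N} \<inter> {w. a # w \<in> A}"
        proof -
          have "subst_letter N a (N # w) = a # w" if "\<forall>i\<in>set w. i < N" for w
            using that by (auto simp: subst_letter_def intro!: map_idI)
          then show ?thesis by auto
        qed
        have "map_ultra (subst_letter N a) ?r A = q {w. subst_letter N a (N # w) \<in> A}"
          by (simp add: map_ultra_def vimage_def)
        also have "\<dots> = q {w. a # w \<in> A}"
          using arg_cong[OF eq, of q] qS by (simp add: ultra_Int)
        finally show "map_ultra (subst_letter N a) ?r A = conv (\<lambda>A. [a] \<in> A) q A"
          by (simp add: conv_def)
      qed
      then show ?thesis using I(4) pS q by (simp add: Q_def)
    qed
    moreover have "?r W"
      unfolding map_ultra_def by (rule ultra_mono[OF qS]) (auto simp: W_def)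
    ultimately have "?r \<in> T" by (simp add: T_def ultra_map qS)
    then show ?thesis by auto
  qed
  moreover have "conv p q \<in> T" if "p \<in> T" "q \<in> T" for p q
  proof -
    have p: "ultra p" "p W" and q: "ultra q" "q W" using that by (auto simp: T_def)
    have "conv p q W"
      unfolding conv_def
    proof (rule ultra_mono[OF p], clarify)
      fix s assume "s \<in> W"
      show "q {t. s @ t \<in> W}"
        by (rule ultra_mono[OF q]) (use \<open>s \<in> W\<close> in \<open>auto simp: W_def\<close>)
    qed
    moreover have "map_ultra (subst_letter N a) (conv p q) \<in> I" if "a < N" for a
    proof -
      have "map_ultra (subst_letter N a) p \<in> I" "map_ultra (subst_letter N a) q \<in> I"
        using \<open>p \<in> T\<close> \<open>q \<in> T\<close> that by (auto simp: T_def)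
      then show ?thesis using I(1,4) by (auto simp: Q_def map_ultra_conv)
    qed
    ultimately show ?thesis using p q by (simp add: T_def ultra_conv)
  qed
  ultimately obtain r where r: "r \<in> T" "conv r r = r" by (rule Ellis_idempotent[of T]) auto
  show ?thesis
  proof (rule that[of r])
    show "ultra r" "r {N # w | w. w \<in> lists {..N}}" using r by (auto simp: T_def W_def)
    fix a b assume "a < N" "b < N"
    then have "map_ultra (subst_letter N a) r \<in> I" "map_ultra (subst_letter N b) r \<in> I"
      using r(1) by (simp_all add: T_def)
    \<comment> \<open>Substitution is a homomorphism for concatenation, so the instances of an
      idempotent are idempotent.\<close>
    moreover have "conv (map_ultra (subst_letter N b) r) (map_ultra (subst_letter N b) r) = map_ultra (subst_letter N b) r"
      using map_ultra_conv[of "subst_letter N b" r r, OF subst_letter_append] unfolding r(2) by (rule sym)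
    ultimately show "conv (map_ultra (subst_letter N a) r) (map_ultra (subst_letter N b) r) =
      map_ultra (subst_letter N a) r"
      by (rule absorb)
  qed
qed


section \<open>Infinite parameter words\<close>

lemma ultra_colour:
  assumes "finite (c ` X)" "ultra p" "p X"
  obtains k where "p {x \<in> X. c x = k}"
proof -
  have "\<exists>k\<in>c ` X. p {x \<in> X. c x = k}"
  proof (rule ccontr)
    assume "\<not> ?thesis"
    then have "p (- {x \<in> X. c x = k})" if "k \<in> c ` X" for k
      using that by (auto simp: ultra_Compl[OF assms(2)])
    then have "p (\<Inter>k\<in>c ` X. - {x \<in> X. c x = k})" by (rule ultra_Inter[OF assms(1,2)])
    then have "p ((\<Inter>k\<in>c ` X. - {x \<in> X. c x = k}) \<inter> X)"
      using assms(3) ultra_Int[OF assms(2)] by blast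
    moreover have "(\<Inter>k\<in>c ` X. - {x \<in> X. c x = k}) \<inter> X = {}" by auto
    ultimately show False using ultra_nonempty[OF assms(2)] by metis
  qed
  then show ?thesis using that by blast
qed

text \<open>An infinite parameter word is the function listing the indices of its parameters, and
  \<open>subst_word V E\<close> is \<open>V(E)\<close>.\<close>

definition infinite_parameter_word :: "(nat \<Rightarrow> nat) \<Rightarrow> bool" where
  "infinite_parameter_word V \<longleftrightarrow> surj V \<and> (\<forall>i. \<forall>j<V i. \<exists>i'<i. V i' = j)"

definition first_pos :: "(nat \<Rightarrow> nat) \<Rightarrow> nat \<Rightarrow> nat" where
  "first_pos V m = (LEAST i. V i = m)"

definition subst_word :: "(nat \<Rightarrow> nat) \<Rightarrow> 'a list \<Rightarrow> 'a list" where
  "subst_word V E = map (\<lambda>i. E ! V i) [0..<first_pos V (length E)]"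

lemma occurs_before:
  assumes "infinite_parameter_word V" "j < V i"
  obtains i' where "i' < i" "V i' = j"
  using assms unfolding infinite_parameter_word_def by blast

lemma nth_first_pos: "infinite_parameter_word V \<Longrightarrow> V (first_pos V m) = m"
  unfolding first_pos_def infinite_parameter_word_def by (rule LeastI_ex) (metis surjD)

lemma first_pos_least: "V i = m \<Longrightarrow> first_pos V m \<le> i"
  unfolding first_pos_def by (rule Least_le)

lemma less_if_less_first_pos:
  assumes "infinite_parameter_word V" "i < first_pos V m"
  shows "V i < m"
proof (rule ccontr)
  assume "\<not> V i < m"
  moreover have "V i \<noteq> m" using first_pos_least[of V i m] assms(2) by auto
  ultimately have "m < V i" by simp
  with assms(1) obtain i' where "i' < i" "V i' = m" by (rule occurs_before)
  then show False using first_pos_least[of V i' m] assms(2) by simp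
qed

lemma first_pos_eqI: "V i = m \<Longrightarrow> (\<And>j. j < i \<Longrightarrow> V j \<noteq> m) \<Longrightarrow> first_pos V m = i"
  unfolding first_pos_def by (rule Least_equality) (auto simp: not_less[symmetric])

lemma first_pos_less_iff:
  assumes "infinite_parameter_word V"
  shows "first_pos V m < first_pos V n \<longleftrightarrow> m < n"
proof -
  have 1: "m < n" if "first_pos V m < first_pos V n" for m n
    using less_if_less_first_pos[OF assms that] nth_first_pos[OF assms] by simp
  have "first_pos V m \<noteq> first_pos V n" if "m \<noteq> n" using that nth_first_pos[OF assms] by metis
  then show ?thesis using 1 by (metis linorder_neqE_nat order_less_asym)
qed

lemma nth_le: "infinite_parameter_word V \<Longrightarrow> V i \<le> i"
proof (induction i rule: less_induct)
  case (less i)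
  show ?case
  proof (rule ccontr)
    assume "\<not> V i \<le> i"
    then have "i < V i" by simp
    with less.prems obtain i' where "i' < i" "V i' = i" by (rule occurs_before)
    then show False using less.IH[of i'] less.prems by simp
  qed
qed

lemma first_pos_ge: "infinite_parameter_word V \<Longrightarrow> m \<le> first_pos V m"
  by (metis nth_first_pos nth_le)

lemma length_subst_word [simp]: "length (subst_word V E) = first_pos V (length E)"
  by (simp add: subst_word_def)

lemma nth_subst_word: "i < first_pos V (length E) \<Longrightarrow> subst_word V E ! i = E ! V i"
  by (simp add: subst_word_def)

lemma first_pos_comp:
  assumes "infinite_parameter_word V" "infinite_parameter_word W"
  shows "first_pos (W \<circ> V) m = first_pos V (first_pos W m)"
proof (rule first_pos_eqI)
  show "(W \<circ> V) (first_pos V (first_pos W m)) = m" using assms by (simp add: nth_first_pos)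
  fix j assume "j < first_pos V (first_pos W m)"
  then have "V j < first_pos W m" by (rule less_if_less_first_pos[OF assms(1)])
  then show "(W \<circ> V) j \<noteq> m" using less_if_less_first_pos[OF assms(2)] by fastforce
qed

lemma infinite_parameter_word_comp:
  assumes "infinite_parameter_word V" "infinite_parameter_word W"
  shows "infinite_parameter_word (W \<circ> V)"
  unfolding infinite_parameter_word_def
proof (intro conjI allI impI)
  show "surj (W \<circ> V)" 
    using assms unfolding infinite_parameter_word_def by (metis comp_surj)
  fix i j assume "j < (W \<circ> V) i"
  then have "j < W (V i)" by simp
  with assms(2) obtain i1 where i1: "i1 < V i" "W i1 = j" by (rule occurs_before)
  from assms(1) i1(1) obtain i' where "i' < i" "V i' = i1" by (rule occurs_before)
  then show "\<exists>i'<i. (W \<circ> V) i' = j" using i1(2) by auto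
qed

text \<open>Viewed as an index function, the parameter word obtained by substituting
  \<open>W\<close> into \<open>V\<close> is \<open>W \<circ> V\<close>, so composites act in
  reversed order. The truncations agree by \<open>first_pos_comp\<close>.\<close>

lemma subst_word_comp:
  assumes "infinite_parameter_word V" "infinite_parameter_word W"
  shows "subst_word (W \<circ> V) E = subst_word V (subst_word W E)"
proof (rule nth_equalityI)
  show "length (subst_word (W \<circ> V) E) = length (subst_word V (subst_word W E))" using assms by (simp add: first_pos_comp)
  fix i assume "i < length (subst_word (W \<circ> V) E)"
  then have i: "i < first_pos V (first_pos W (length E))" using assms by (simp add: first_pos_comp)
  then show "subst_word (W \<circ> V) E ! i = subst_word V (subst_word W E) ! i"
    using assms less_if_less_first_pos[OF assms(1) i] by (simp add: first_pos_comp nth_subst_word)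
qed

lemma infinite_parameter_word_id: "infinite_parameter_word (\<lambda>i. i)"
  by (auto simp: infinite_parameter_word_def)

text \<open>The first \<open>N\<close> parameters of \<open>V\<close> play the role of the letters of a finite alphabet, so the words
  in the last clause are the instances of an infinite sequence of variable words.\<close>

proposition Carlson_Simpson:
  fixes c :: "nat list \<Rightarrow> 'c"
  assumes "N > 0" "finite (c ` lists {..<N})"
  obtains V k where "infinite_parameter_word V" "\<And>i. i < N \<Longrightarrow> V i = i"
    "\<And>Y. Y \<in> lists {..<N} \<Longrightarrow> c (drop N (subst_word V ([0..<N] @ Y))) = k"
proof -
  obtain r where r: "ultra r" "r {N # w | w. w \<in> lists {..N}}"
    "\<And>a b. a < N \<Longrightarrow> b < N \<Longrightarrow> conv (map_ultra (subst_letter N a) r) (map_ultra (subst_letter N b) r) =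
      map_ultra (subst_letter N a) r"
    by (rule variable_word_ultrafilter[OF assms(1)]) blast
  define q where "q b = map_ultra (subst_letter N b) r" for b
  have uq: "ultra (q b)" for b by (simp add: q_def ultra_map r(1))
  \<comment> \<open>The absorption law with \<open>conv\<close> unfolded.\<close>
  have qq: "q a {v. q b {w. v @ w \<in> A}} = q a A" if "a < N" "b < N" for a b A
    using fun_cong[OF r(3)[OF that], of A] by (simp add: conv_def q_def)
  have "q 0 (lists {..<N})"
    unfolding q_def map_ultra_def
    by (rule ultra_mono[OF r(1,2)]) (use assms(1) in \<open>auto simp: subst_letter_def intro!: le_neq_implies_less\<close>)
  then obtain k where k: "q 0 {w \<in> lists {..<N}. c w = k}"
    by (rule ultra_colour[OF assms(2) uq])
  define C where "C = {w \<in> lists {..<N}. c w = k}"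
  have kC: "q 0 C" using k by (simp only: C_def)
  \<comment> \<open>If \<open>w \<in> C'\<close>, then \<open>w @ v(b) \<in> C'\<close> for all letters \<open>b\<close> and \<open>r\<close>-almost all variable words \<open>v\<close>.\<close>
  define C' where "C' = C \<inter> (\<Inter>b\<in>{..<N}. {w. q b {v. w @ v \<in> C}})"
  \<comment> \<open>By absorption, each of these finitely many sets is large for \<open>q 0\<close>
    because \<open>C\<close> is.\<close>
  have "q 0 (\<Inter>b\<in>{..<N}. {w. q b {v. w @ v \<in> C}})"
    by (rule ultra_Inter[OF _ uq]) (use assms(1) kC qq in auto)
  then have "q 0 C'" using kC ultra_Int[OF uq] unfolding C'_def by blast
  then obtain w0 where w0: "w0 \<in> C'" using ultra_nonempty[OF uq] by blast
  have step: "q b {v. w @ v \<in> C'}" if "w \<in> C'" "b < N" for w b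
  proof -
    have wC: "q b {v. w @ v \<in> C}" if "b < N" for b using \<open>w \<in> C'\<close> that by (auto simp: C'_def)
    \<comment> \<open>Absorption is used again, now for the set of continuations of
      \<open>w\<close>: almost every \<open>v\<close> that keeps \<open>w @ v\<close> in
      \<open>C\<close> also keeps almost all further extensions in \<open>C\<close>. This is what
      makes \<open>C'\<close> self-reproducing.\<close>
    have "q b (\<Inter>a\<in>{..<N}. {v. q a {u. v @ u \<in> {x. w @ x \<in> C}}})"
    proof (rule ultra_Inter[OF _ uq])
      fix a assume "a \<in> {..<N}"
      then show "q b {v. q a {u. v @ u \<in> {x. w @ x \<in> C}}}"
        using qq[OF \<open>b < N\<close>, of a "{x. w @ x \<in> C}"] wC[OF \<open>b < N\<close>] by blast
    qed simp
    then have "q b ({v. w @ v \<in> C} \<inter> (\<Inter>a\<in>{..<N}. {v. q a {u. v @ u \<in> {x. w @ x \<in> C}}}))"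
      using wC[OF \<open>b < N\<close>] ultra_Int[OF uq] by blast
    then show ?thesis by (rule ultra_mono[OF uq]) (auto simp: C'_def)
  qed
  \<comment> \<open>The requirement on the next block \<open>x\<close>: it begins with the variable,
    and every instance of it prolongs every word of \<open>F\<close> inside
    \<open>C'\<close>.\<close>
  define Q where "Q F x \<longleftrightarrow> x \<in> {N # w | w. w \<in> lists {..N}} \<and> (\<forall>w\<in>F. \<forall>b<N. w @ subst_letter N b x \<in> C')"
    for F x
  have ex: "\<exists>x. Q F x" if F: "finite F" "F \<subseteq> C'" for F
  proof -
    have "r (\<Inter>(w, b)\<in>F \<times> {..<N}. {x. w @ subst_letter N b x \<in> C'})"
    proof (rule ultra_Inter[OF _ r(1)])
      fix i assume "i \<in> F \<times> {..<N}"
      then show "r (case i of (w, b) \<Rightarrow> {x. w @ subst_letter N b x \<in> C'})"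
        using step F by (auto simp: q_def map_ultra_def vimage_def)
    qed (use F in simp)
    then have "r ({N # w | w. w \<in> lists {..N}} \<inter> (\<Inter>(w, b)\<in>F \<times> {..<N}. {x. w @ subst_letter N b x \<in> C'}))"
      using r(2) ultra_Int[OF r(1)] by blast
    from ultra_nonempty[OF r(1) this] show ?thesis unfolding Q_def by blast
  qed
  define g where "g F = (SOME x. Q F x)" for F
  have g: "Q F (g F)" if "finite F" "F \<subseteq> C'" for F
    unfolding g_def using ex[OF that] by (rule someI_ex)
  \<comment> \<open>\<open>F m\<close> consists of \<open>w0\<close> followed by all choices of
    instances of the first \<open>m\<close> blocks.\<close>
  define F where "F = rec_nat {w0} (\<lambda>_ F. (\<lambda>(w, b). w @ subst_letter N b (g F)) ` (F \<times> {..<N}))"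
  have F_simps: "F 0 = {w0}" "\<And>m. F (Suc m) = (\<lambda>(w, b). w @ subst_letter N b (g (F m))) ` (F m \<times> {..<N})"
    by (simp_all add: F_def)
  have F: "finite (F m) \<and> F m \<subseteq> C'" for m
  proof (induction m)
    case 0 then show ?case using w0 by (simp add: F_simps)
  next
    case (Suc m)
    then show ?case using g[of "F m"] by (auto simp: F_simps Q_def)
  qed
  define x where "x m = g (F m)" for m
  have x: "\<exists>w. x m = N # w \<and> set w \<subseteq> {..N}" for m
    using g[of "F m"] F[of m] by (auto simp: x_def Q_def)
  \<comment> \<open>The finite prefixes of \<open>V\<close>: block \<open>m\<close> is copied with
    its variable renamed to the parameter \<open>N + m\<close>. As the block begins with its
    variable, this parameter first occurs exactly where the block starts.\<close>
  define P where "P = rec_nat ([0..<N] @ w0) (\<lambda>m p. p @ subst_letter N (N + m) (x m))"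
  have P_simps: "P 0 = [0..<N] @ w0" "\<And>m. P (Suc m) = P m @ subst_letter N (N + m) (x m)"
    by (simp_all add: P_def)
  have x_hd: "subst_letter N a (x m) = a # tl (subst_letter N a (x m))" for a m
    using x[of m] by (auto simp: subst_letter_def)
  have P_set: "set (P m) \<subseteq> {..<N + m}" for m
  proof (induction m)
    case 0 then show ?case using w0 by (auto simp: P_simps C'_def C_def)
  next
    case (Suc m)
    moreover have "set (subst_letter N (N + m) (x m)) \<subseteq> {..<N + Suc m}"
      using x[of m] assms(1) by (auto simp: subst_letter_def)
    ultimately show ?case by (auto simp: P_simps)
  qed
  have P_len: "m + N \<le> length (P m)" for m
  proof (induction m)
    case (Suc m)
    have "Suc 0 \<le> length (subst_letter N (N + m) (x m))" by (subst x_hd) simp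
    then show ?case using Suc by (simp add: P_simps)
  qed (simp add: P_simps)
  have P_mono: "\<exists>u. P n = P m @ u" if "m \<le> n" for m n
    using that by (induction n rule: dec_induct) (auto simp: P_simps)
  have P_less: "length (P m) < length (P n)" if "m < n" for m n
  proof -
    obtain u where "P n = P (Suc m) @ u" using P_mono[of "Suc m" n] \<open>m < n\<close> by auto
    moreover have "subst_letter N (N + m) (x m) \<noteq> []" by (subst x_hd) simp
    ultimately show ?thesis by (simp add: P_simps)
  qed
  \<comment> \<open>The prefix \<open>P (Suc i)\<close> has length at least
    \<open>Suc i + N\<close>, so position \<open>i\<close> is already defined there.\<close>
  define V where "V i = P (Suc i) ! i" for i
  have V: "V i = P m ! i" if "i < length (P m)" for i m
  proof -
    have *: "P n ! i = P m ! i" if "m \<le> n" "i < length (P m)" for m n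
      using P_mono[OF that(1)] that(2) by (auto simp: nth_append)
    have "i < length (P (Suc i))" using P_len[of "Suc i"] by simp
    then show ?thesis using *[of m "Suc i"] *[of "Suc i" m] that nat_le_linear[of m "Suc i"]
      unfolding V_def by auto
  qed
  have V_small: "V i = i" if "i < N" for i
    using V[of i 0] that by (simp add: P_simps nth_append)
  have V_new: "V (length (P m)) = N + m" for m
  proof -
    have "V (length (P m)) = P (Suc m) ! length (P m)" using V P_less[of m "Suc m"] by simp
    also have "\<dots> = subst_letter N (N + m) (x m) ! 0" by (simp add: P_simps nth_append)
    also have "\<dots> = N + m" by (subst x_hd) simp
    finally show ?thesis .
  qed
  have V_less: "V i < N + m" if "i < length (P m)" for i m
    using V[OF that] P_set[of m] nth_mem[OF that] by auto
  have foV: "first_pos V (N + m) = length (P m)" for m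
    by (rule first_pos_eqI) (use V_new V_less in fastforce)+
  have ipw: "infinite_parameter_word V"
    unfolding infinite_parameter_word_def
  proof (intro conjI allI impI)
    have "\<exists>i. V i = y" for y
      using V_small[of y] V_new[of "y - N"] by (cases "y < N") auto
    then show "surj V" by (metis surjI)
    fix i j assume j: "j < V i"
    show "\<exists>i'<i. V i' = j"
    proof (cases "j < N")
      case True
      then have "j < i" using V_small[of i] j by (cases "i < N") auto
      then show ?thesis using V_small[OF True] by auto
    next
      case False
      then have "N + (j - N) = j" by simp
      then have "\<not> i < length (P (j - N))" using V_less[of i "j - N"] j by auto
      moreover have "i \<noteq> length (P (j - N))" using V_new[of "j - N"] j False by auto
      ultimately show ?thesis using V_new[of "j - N"] False by (intro exI[of _ "length (P (j - N))"]) auto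
    qed
  qed
  have app: "subst_word V ([0..<N] @ Y) = map (\<lambda>i. ([0..<N] @ Y) ! i) (P (length Y))" for Y
  proof (rule nth_equalityI)
    show "length (subst_word V ([0..<N] @ Y)) = length (map (\<lambda>i. ([0..<N] @ Y) ! i) (P (length Y)))"
      by (simp add: foV)
    fix i assume "i < length (subst_word V ([0..<N] @ Y))"
    then have "i < length (P (length Y))" by (simp add: foV)
    then show "subst_word V ([0..<N] @ Y) ! i = map (\<lambda>i. ([0..<N] @ Y) ! i) (P (length Y)) ! i"
      using V by (simp add: nth_subst_word foV)
  qed
  \<comment> \<open>Substituting \<open>Y\<close> for the parameters from \<open>N\<close> on
    instantiates block \<open>m\<close> with \<open>Y ! m\<close>; after the \<open>N\<close> fixed
    letters there remains a word of \<open>F (length Y)\<close>, hence a word of colour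
    \<open>k\<close>.\<close>
  have "\<exists>u\<in>F (length Y). map (\<lambda>i. ([0..<N] @ Y) ! i) (P (length Y)) = [0..<N] @ u"
    if "Y \<in> lists {..<N}" for Y
    using that
  proof (induction Y rule: rev_induct)
    case Nil
    have "map (\<lambda>i. [0..<N] ! i) w0 = w0"
      using w0 by (intro map_idI) (auto simp: C'_def C_def)
    moreover have "map (\<lambda>i. [0..<N] ! i) [0..<N] = [0..<N]" by (rule map_idI) simp
    ultimately show ?case by (simp add: P_simps F_simps)
  next
    case (snoc b Y)
    then obtain u where u: "u \<in> F (length Y)"
      "map (\<lambda>i. ([0..<N] @ Y) ! i) (P (length Y)) = [0..<N] @ u" by auto
    have "map (\<lambda>i. ([0..<N] @ Y @ [b]) ! i) (P (length Y)) = map (\<lambda>i. ([0..<N] @ Y) ! i) (P (length Y))"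
    proof (rule map_cong[OF refl])
      fix i assume "i \<in> set (P (length Y))"
      then have "i < N + length Y" using P_set by auto
      then show "([0..<N] @ Y @ [b]) ! i = ([0..<N] @ Y) ! i"
        by (auto simp: nth_append)
    qed
    moreover have "map (\<lambda>i. ([0..<N] @ Y @ [b]) ! i) (subst_letter N (N + length Y) (x (length Y))) =
        subst_letter N b (x (length Y))"
      unfolding subst_letter_def map_map
    proof (rule map_cong[OF refl])
      fix i assume "i \<in> set (x (length Y))"
      then have "i \<le> N" using x[of "length Y"] by auto
      then show "((\<lambda>i. ([0..<N] @ Y @ [b]) ! i) \<circ> (\<lambda>i. if i = N then N + length Y else i)) i =
          (if i = N then b else i)"
        by (auto simp: nth_append)
    qed
    ultimately have "map (\<lambda>i. ([0..<N] @ Y @ [b]) ! i) (P (length (Y @ [b]))) =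
        [0..<N] @ u @ subst_letter N b (x (length Y))"
      using u(2) by (simp add: P_simps)
    moreover have "u @ subst_letter N b (x (length Y)) \<in> F (length (Y @ [b]))"
      using u(1) snoc.prems by (auto simp: F_simps x_def)
    ultimately show ?case by blast
  qed
  then have "c (drop N (subst_word V ([0..<N] @ Y))) = k" if "Y \<in> lists {..<N}" for Y
    using that F unfolding app by (fastforce simp: C'_def C_def)
  then show ?thesis using that ipw V_small by blast
qed


section \<open>The Ramsey theorem for parameter words\<close>

lemma first_occ_less: "i \<in> set W \<Longrightarrow> first_occ W i < length W"
  unfolding first_occ_def by (induction W) auto

lemma nth_first_occ: "i \<in> set W \<Longrightarrow> W ! first_occ W i = i"
  unfolding first_occ_def by (induction W) auto

lemma first_occ_le:
  assumes "p < length W" "W ! p = i"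
  shows "first_occ W i \<le> p"
proof (rule ccontr)
  assume "\<not> first_occ W i \<le> p"
  then have "p < length (takeWhile (\<lambda>x. x \<noteq> i) W)" by (simp add: first_occ_def)
  then have "W ! p \<noteq> i" by (metis (mono_tags) nth_mem set_takeWhileD takeWhile_nth)
  then show False using assms(2) by simp
qed

lemma first_occ_eqI:
  assumes "p < length W" "W ! p = i" "\<And>j. j < p \<Longrightarrow> W ! j \<noteq> i"
  shows "first_occ W i = p"
proof -
  have "i \<in> set W" using assms(1,2) by auto
  then have "\<not> first_occ W i < p" using assms(3) nth_first_occ by blast
  then show ?thesis using first_occ_le[OF assms(1,2)] by simp
qed

text \<open>The order of first occurrences in local form: before each entry, all smaller values have
  occurred. Infinite parameter words are defined by the same condition, which makes the two kinds
  fit together under substitution.\<close>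

lemma parameter_word_iff:
  "parameter_word d W \<longleftrightarrow> set W = {..<d} \<and> (\<forall>i<length W. \<forall>j<W ! i. \<exists>i'<i. W ! i' = j)"
    (is "_ \<longleftrightarrow> _ \<and> ?grow")
proof (cases "set W = {..<d}")
  case set: True
  have "(\<forall>j. 1 \<le> j \<and> j < d \<longrightarrow> first_occ W (j - 1) < first_occ W j) \<longleftrightarrow> ?grow"
  proof
    assume inc: "\<forall>j. 1 \<le> j \<and> j < d \<longrightarrow> first_occ W (j - 1) < first_occ W j"
    have less: "first_occ W j < first_occ W v" if "j < v" "v < d" for j v
      using that
    proof (induction v)
      case (Suc v)
      have "first_occ W v < first_occ W (Suc v)" using inc Suc.prems by force
      then show ?case using Suc by (cases "j = v") auto
    qed simp
    show ?grow
    proof (intro allI impI)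
      fix i j assume ij: "i < length W" "j < W ! i"
      then have "W ! i < d" using set nth_mem by blast
      then have "first_occ W j < first_occ W (W ! i)" using less ij by blast
      also have "\<dots> \<le> i" using first_occ_le ij by blast
      finally show "\<exists>i'<i. W ! i' = j" using nth_first_occ[of j W] set ij \<open>W ! i < d\<close> by auto
    qed
  next
    assume grow: ?grow
    show "\<forall>j. 1 \<le> j \<and> j < d \<longrightarrow> first_occ W (j - 1) < first_occ W j"
    proof (intro allI impI)
      fix j assume j: "1 \<le> j \<and> j < d"
      then have js: "j \<in> set W" using set by simp
      have "j - 1 < W ! first_occ W j" using nth_first_occ[OF js] j by simp
      then obtain i' where "i' < first_occ W j" "W ! i' = j - 1"
        using grow first_occ_less[OF js] by blast
      then show "first_occ W (j - 1) < first_occ W j"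
        using first_occ_le[of i' W "j - 1"] first_occ_less[OF js] by linarith
    qed
  qed
  then show ?thesis using set by (simp add: parameter_word_def)
qed (simp add: parameter_word_def)

lemma parameter_word_0: "parameter_word 0 W \<longleftrightarrow> W = []"
  by (auto simp: parameter_word_def)

lemma parameter_word_subst_word:
  assumes V: "infinite_parameter_word V" and W: "parameter_word d W"
  shows "parameter_word d (subst_word V W)"
  unfolding parameter_word_iff
proof (intro conjI allI impI)
  have set: "set W = {..<d}" and grow: "\<And>i j. i < length W \<Longrightarrow> j < W ! i \<Longrightarrow> \<exists>i'<i. W ! i' = j"
    using W by (auto simp: parameter_word_iff)
  have "set (subst_word V W) = set W"
  proof
    show "set (subst_word V W) \<subseteq> set W"
      using less_if_less_first_pos[OF V] by (auto simp: subst_word_def)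
    show "set W \<subseteq> set (subst_word V W)"
    proof
      fix y assume "y \<in> set W"
      then obtain p where p: "p < length W" "W ! p = y" by (metis in_set_conv_nth)
      then have "first_pos V p < length (subst_word V W)" using first_pos_less_iff[OF V] by simp
      moreover from this have "subst_word V W ! first_pos V p = y" using p nth_first_pos[OF V] by (simp add: nth_subst_word)
      ultimately show "y \<in> set (subst_word V W)" by (metis nth_mem)
    qed
  qed
  then show "set (subst_word V W) = {..<d}" using set by simp
  fix i j assume i: "i < length (subst_word V W)" and j: "j < subst_word V W ! i"
  then have "V i < length W" using less_if_less_first_pos[OF V] by simp
  moreover have "j < W ! V i" using i j by (simp add: nth_subst_word)
  ultimately obtain p where p: "p < V i" "W ! p = j" using grow by blast
  from V p(1) obtain i' where "i' < i" "V i' = p" by (rule occurs_before)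
  then show "\<exists>i'<i. subst_word V W ! i' = j" using i p by (intro exI[of _ i']) (simp add: nth_subst_word)
qed

lemma parameter_word_Suc_append:
  assumes "parameter_word d E" "Z \<in> lists {..d}"
  shows "parameter_word (Suc d) (E @ d # Z)"
  unfolding parameter_word_iff
proof (intro conjI allI impI)
  have set: "set E = {..<d}" and grow: "\<And>i j. i < length E \<Longrightarrow> j < E ! i \<Longrightarrow> \<exists>i'<i. E ! i' = j"
    using assms by (auto simp: parameter_word_iff)
  show s: "set (E @ d # Z) = {..<Suc d}" using set assms(2) by auto
  fix i j assume i: "i < length (E @ d # Z)" and j: "j < (E @ d # Z) ! i"
  show "\<exists>i'<i. (E @ d # Z) ! i' = j"
  proof (cases "i < length E")
    case True
    then obtain i' where "i' < i" "E ! i' = j" using grow j by (auto simp: nth_append)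
    then show ?thesis using True by (intro exI[of _ i']) (simp add: nth_append)
  next
    case False
    have "(E @ d # Z) ! i \<in> {..<Suc d}" using i s nth_mem by blast
    then have "j \<in> set E" using j set by auto
    then obtain p where "p < length E" "E ! p = j" by (metis in_set_conv_nth)
    then show ?thesis using False by (intro exI[of _ p]) (simp add: nth_append)
  qed
qed

text \<open>The cut is at the first occurrence of the last parameter \<open>d\<close>; all smaller
  parameters must have occurred before it.\<close>

lemma parameter_word_SucE:
  assumes "parameter_word (Suc d) W"
  obtains E Z where "W = E @ d # Z" "parameter_word d E" "Z \<in> lists {..d}"
proof -
  have set: "set W = {..<Suc d}" and grow: "\<And>i j. i < length W \<Longrightarrow> j < W ! i \<Longrightarrow> \<exists>i'<i. W ! i' = j"
    using assms by (auto simp: parameter_word_iff)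
  define p where "p = first_occ W d"
  have p: "p < length W" "W ! p = d" using set nth_first_occ[of d W] first_occ_less[of d W] by (auto simp: p_def)
  have W: "W = take p W @ d # drop (Suc p) W" using id_take_nth_drop[OF p(1)] p(2) by simp
  have "set (take p W) = {..<d}"
  proof
    show "set (take p W) \<subseteq> {..<d}"
    proof
      fix y assume "y \<in> set (take p W)"
      then obtain i where i: "i < p" "W ! i = y" using p by (auto simp: in_set_conv_nth)
      then have "y \<noteq> d" using first_occ_le[of i W d] p by (auto simp: p_def)
      moreover have "y \<in> set W" using \<open>y \<in> set (take p W)\<close> by (rule in_set_takeD)
      ultimately show "y \<in> {..<d}" using set by auto
    qed
    show "{..<d} \<subseteq> set (take p W)"
    proof
      fix y assume "y \<in> {..<d}"
      then obtain i where "i < p" "W ! i = y" using grow[of p y] p by auto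
      then show "y \<in> set (take p W)" using p by (auto simp: in_set_conv_nth intro!: exI[of _ i])
    qed
  qed
  moreover have "\<exists>i'<i. take p W ! i' = j" if "i < length (take p W)" "j < take p W ! i" for i j
  proof -
    have "i < length W" "j < W ! i" using that by auto
    then obtain i' where "i' < i" "W ! i' = j" using grow by blast
    then show ?thesis using that(1) by (intro exI[of _ i']) auto
  qed
  ultimately have "parameter_word d (take p W)" by (simp add: parameter_word_iff)
  moreover have "set (drop (Suc p) W) \<subseteq> {..d}"
    using set_drop_subset[of "Suc p" W] unfolding set lessThan_Suc_atMost .
  then have "drop (Suc p) W \<in> lists {..d}" by auto
  ultimately show ?thesis by (rule that[OF W])
qed

section \<open>Substitution into words \<open>E @ d # Z\<close>, and fusion\<close>

text \<open>Substitution only repeats and moves entries, so it commutes with letterwise maps. This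
  allows one statement about position words to be transferred to all words \<open>E\<close> of the
  same length.\<close>

lemma subst_word_map:
  assumes "infinite_parameter_word V"
  shows "subst_word V (map f X) = map f (subst_word V X)"
  using less_if_less_first_pos[OF assms] by (auto simp: subst_word_def)

lemma set_subst_word_subset:
  assumes "infinite_parameter_word V"
  shows "set (subst_word V X) \<subseteq> set X"
  using less_if_less_first_pos[OF assms] by (auto simp: subst_word_def)

text \<open>\<open>V(X)\<close> stops just before the first occurrence of the parameter
  \<open>length X\<close>. For the longer word this parameter is replaced by \<open>y\<close>, so
  \<open>V\<close> preserves the shape of an initial part followed by \<open>y\<close> and a
  tail.\<close>

lemma subst_word_append_Cons:
  assumes V: "infinite_parameter_word V"
  obtains Z' where "subst_word V (X @ y # Z) = subst_word V X @ y # Z'" "set Z' \<subseteq> set (X @ y # Z)"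
proof -
  let ?w = "subst_word V (X @ y # Z)" and ?p = "first_pos V (length X)"
  have p: "?p < length ?w" using first_pos_less_iff[OF V] by simp
  have "take ?p ?w = subst_word V X"
  proof (rule nth_equalityI)
    show "length (take ?p ?w) = length (subst_word V X)" using p by simp
    fix i assume "i < length (take ?p ?w)"
    then have i: "i < ?p" "i < first_pos V (length (X @ y # Z))" by auto
    then show "take ?p ?w ! i = subst_word V X ! i"
      using less_if_less_first_pos[OF V i(1)] by (simp add: nth_subst_word nth_append)
  qed
  moreover have "?w ! ?p = y" using p nth_first_pos[OF V] by (simp add: nth_subst_word)
  ultimately have "?w = subst_word V X @ y # drop (Suc ?p) ?w"
    using id_take_nth_drop[OF p] by simp
  moreover have "set (drop (Suc ?p) ?w) \<subseteq> set (X @ y # Z)"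
    using set_subst_word_subset[OF V] set_drop_subset by fastforce
  ultimately show ?thesis using that by blast
qed

lemma subst_word_initial:
  assumes "\<And>i. i \<le> length X \<Longrightarrow> V i = i"
  shows "subst_word V X = X"
proof -
  have "first_pos V (length X) = length X" by (rule first_pos_eqI) (use assms in auto)
  then show ?thesis using assms by (auto simp: subst_word_def intro!: nth_equalityI)
qed

lemma subst_word_upt_append:
  assumes V: "infinite_parameter_word V" and fixed: "\<And>i. i < N \<Longrightarrow> V i = i"
  shows "subst_word V ([0..<N] @ Y) = [0..<N] @ drop N (subst_word V ([0..<N] @ Y))"
proof -
  have "N \<le> first_pos V (N + length Y)" using first_pos_ge[OF V, of "N + length Y"] by simp
  then have "take N (subst_word V ([0..<N] @ Y)) = [0..<N]"
    by (intro nth_equalityI) (auto simp: nth_subst_word fixed nth_append)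
  then show ?thesis by (metis append_take_drop_id)
qed

text \<open>The \<open>m + 1\<close> positions of \<open>E @ [d]\<close> serve as letters for
  \<open>Carlson_Simpson\<close>. A word over them encodes a tail \<open>Z\<close> by lookup in
  \<open>E @ [d]\<close>, and one word of positions encodes a tail for every \<open>E\<close> of
  length \<open>m\<close> simultaneously. \<open>U\<close> stands for the parameter word accumulated
  so far.\<close>

lemma fusion_step:
  fixes c :: "nat list \<Rightarrow> 'c"
  assumes fin: "finite (c ` {X. parameter_word (Suc d) X})" and U: "infinite_parameter_word U"
  obtains V where "infinite_parameter_word V" "\<And>i. i \<le> m \<Longrightarrow> V i = i"
    "\<And>E Z Z'. length E = m \<Longrightarrow> parameter_word d E \<Longrightarrow> Z \<in> lists {..d} \<Longrightarrow> Z' \<in> lists {..d} \<Longrightarrow>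
      c (subst_word U (subst_word V (E @ d # Z))) = c (subst_word U (subst_word V (E @ d # Z')))"
proof -
  define \<E> where "\<E> = {E. length E = m \<and> parameter_word d E}"
  \<comment> \<open>The colour of a position word is the whole function sending \<open>E\<close> to
    the colour of the decoded word. The value \<open>undefined\<close> outside \<open>\<E>\<close>
    puts it into a finite extensional function space.\<close>
  define col where "col X = (\<lambda>E. if E \<in> \<E> then c (subst_word U (E @ d # map ((!) (E @ [d])) X)) else undefined)"
    for X
  have fE: "finite \<E>"
    by (rule finite_subset[OF _ finite_lists_length_eq[of "{..<d}" m]])
      (auto simp: \<E>_def parameter_word_def)
  have "col ` lists {..<Suc m} \<subseteq> \<E> \<rightarrow>\<^sub>E c ` {X. parameter_word (Suc d) X}"
  proof (intro image_subsetI PiE_I)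
    fix X E assume X: "X \<in> lists {..<Suc m}" and E: "E \<in> \<E>"
    have "set (map ((!) (E @ [d])) X) \<subseteq> set (E @ [d])"
    proof
      fix y assume "y \<in> set (map ((!) (E @ [d])) X)"
      then obtain i where "i \<in> set X" "y = (E @ [d]) ! i" by auto
      moreover then have "i < length (E @ [d])" using X E by (auto simp: \<E>_def)
      ultimately show "y \<in> set (E @ [d])" by (metis nth_mem)
    qed
    moreover have "set (E @ [d]) \<subseteq> {..d}" using E by (auto simp: \<E>_def parameter_word_def)
    ultimately have "map ((!) (E @ [d])) X \<in> lists {..d}" by (meson in_listsI subset_trans subsetD)
    then have "parameter_word (Suc d) (subst_word U (E @ d # map ((!) (E @ [d])) X))"
      using E by (intro parameter_word_subst_word[OF U] parameter_word_Suc_append) (auto simp: \<E>_def)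
    then show "col X E \<in> c ` {X. parameter_word (Suc d) X}"
      using E unfolding col_def by simp
  qed (simp add: col_def)
  then have "finite (col ` lists {..<Suc m})"
    using fE fin by (meson finite_PiE finite_subset)
  then obtain V k where V: "infinite_parameter_word V" "\<And>i. i < Suc m \<Longrightarrow> V i = i"
    "\<And>Y. Y \<in> lists {..<Suc m} \<Longrightarrow> col (drop (Suc m) (subst_word V ([0..<Suc m] @ Y))) = k"
    by (rule Carlson_Simpson[OF zero_less_Suc]) blast
  have "c (subst_word U (subst_word V (E @ d # Z))) = k E"
    if E: "length E = m" "parameter_word d E" and Z: "Z \<in> lists {..d}" for E Z
  proof -
    \<comment> \<open>Every entry of \<open>Z\<close> occurs in \<open>E @ [d]\<close>, because
      \<open>E\<close> contains all parameters below \<open>d\<close>; so each tail has a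
      code.\<close>
    have "\<forall>z\<in>set Z. \<exists>i<Suc m. (E @ [d]) ! i = z"
    proof
      fix z assume "z \<in> set Z"
      then have "z \<in> set (E @ [d])" using E(2) Z by (auto simp: parameter_word_def)
      then show "\<exists>i<Suc m. (E @ [d]) ! i = z" using E(1) unfolding in_set_conv_nth by simp
    qed
    from bchoice[OF this] obtain h where h: "\<forall>z\<in>set Z. h z < Suc m \<and> (E @ [d]) ! h z = z" ..
    define Y where "Y = map h Z"
    have Y: "Y \<in> lists {..<Suc m}" "map ((!) (E @ [d])) Y = Z"
      using h by (auto simp: Y_def intro: map_idI)
    have "map ((!) (E @ [d])) [0..<Suc m] = E @ [d]"
      using map_nth[of "E @ [d]"] E(1) by simp
    then have EZ: "E @ d # Z = map ((!) (E @ [d])) ([0..<Suc m] @ Y)"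
      using Y(2) by (simp del: upt_Suc)
    have "subst_word V (E @ d # Z) = map ((!) (E @ [d])) (subst_word V ([0..<Suc m] @ Y))"
      unfolding EZ by (rule subst_word_map[OF V(1)])
    also have "\<dots> = map ((!) (E @ [d])) ([0..<Suc m] @ drop (Suc m) (subst_word V ([0..<Suc m] @ Y)))"
      using subst_word_upt_append[of V "Suc m" Y, OF V(1,2)] by (rule arg_cong)
    also have "\<dots> = E @ d # map ((!) (E @ [d])) (drop (Suc m) (subst_word V ([0..<Suc m] @ Y)))"
      unfolding map_append \<open>map ((!) (E @ [d])) [0..<Suc m] = E @ [d]\<close> by simp
    finally have "c (subst_word U (subst_word V (E @ d # Z))) =
        col (drop (Suc m) (subst_word V ([0..<Suc m] @ Y))) E"
      using E by (simp only: col_def \<E>_def mem_Collect_eq simp_thms if_True)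
    then show ?thesis unfolding V(3)[OF Y(1)] .
  qed
  then show ?thesis using that[of V] V(1,2) by (metis less_Suc_eq_le)
qed

lemma fusion:
  fixes c :: "nat list \<Rightarrow> 'c"
  assumes fin: "finite (c ` {X. parameter_word (Suc d) X})"
  obtains W where "infinite_parameter_word W"
    "\<And>E Z Z'. parameter_word d E \<Longrightarrow> Z \<in> lists {..d} \<Longrightarrow> Z' \<in> lists {..d} \<Longrightarrow>
      c (subst_word W (E @ d # Z)) = c (subst_word W (E @ d # Z'))"
proof -
  \<comment> \<open>Step \<open>m\<close> treats the words \<open>E\<close> of length \<open>m\<close> and leaves the first \<open>m + 1\<close> parameters untouched, so the
    composites stabilise and their limit is \<open>W i = w i i\<close>.\<close>
  define good where "good U m V \<longleftrightarrow> infinite_parameter_word V \<and> (\<forall>i\<le>m. V i = i) \<and>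
    (\<forall>E Z Z'. length E = m \<longrightarrow> parameter_word d E \<longrightarrow> Z \<in> lists {..d} \<longrightarrow> Z' \<in> lists {..d} \<longrightarrow>
      c (subst_word U (subst_word V (E @ d # Z))) = c (subst_word U (subst_word V (E @ d # Z'))))" for U m V
  have ex: "\<exists>V. good U m V" if "infinite_parameter_word U" for U m
    by (rule fusion_step[OF fin that, of m]) (unfold good_def, blast)
  define V where "V U m = (SOME V. good U m V)" for U m
  have V: "good U m (V U m)" if "infinite_parameter_word U" for U m
    unfolding V_def using ex[OF that] by (rule someI_ex)
  define w where "w = rec_nat (\<lambda>i. i) (\<lambda>m U. V U m \<circ> U)"
  have w_simps: "w 0 = (\<lambda>i. i)" "\<And>m. w (Suc m) = V (w m) m \<circ> w m" by (simp_all add: w_def)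
  have w: "infinite_parameter_word (w m)" for m
  proof (induction m)
    case 0 show ?case by (simp add: w_simps infinite_parameter_word_id)
  next
    case (Suc m)
    have "infinite_parameter_word (V (w m) m)" using V[OF Suc, of m] unfolding good_def by blast
    then show ?case unfolding w_simps by (rule infinite_parameter_word_comp[OF Suc])
  qed
  have Vw: "good (w m) m (V (w m) m)" for m by (rule V[OF w])
  then have Vi: "infinite_parameter_word (V (w m) m)" for m unfolding good_def by blast
  have Vfix: "V (w m) m i = i" if "i \<le> m" for i m using Vw[of m] that unfolding good_def by blast
  \<comment> \<open>Since \<open>w n i \<le> i \<le> n\<close>, the next factor fixes the value
    \<open>w n i\<close>.\<close>
  have stable: "w n i = w m i" if "m \<le> n" "i \<le> m" for n m i
    using that
  proof (induction n rule: dec_induct)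
    case (step n)
    have "w n i \<le> n" using nth_le[OF w, of n i] step by simp
    then show ?case using step Vfix by (simp add: w_simps)
  qed simp
  have first_pos_stable: "first_pos (w n) y = first_pos (w m) y" if "m \<le> n" "y \<le> m" for n m y
    using that
  proof (induction n rule: dec_induct)
    case (step n)
    have "first_pos (V (w n) n) y = y" by (rule first_pos_eqI) (use Vfix step in auto)
    then show ?case unfolding w_simps first_pos_comp[OF w Vi] using step by simp
  qed simp
  define W where "W i = w i i" for i
  have Ww: "W i = w n i" if "i \<le> n" for i n using stable[OF that] by (simp add: W_def)
  have W_fo: "first_pos W y = first_pos (w n) y" if "y \<le> n" for y n
  proof -
    \<comment> \<open>A stage at which all positions up to the first occurrence of \<open>y\<close>
      have reached their final values.\<close>
    let ?k = "max n (first_pos (w n) y)"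
    have foy: "first_pos (w ?k) y = first_pos (w n) y" by (rule first_pos_stable) (use that in auto)
    show ?thesis
    proof (rule first_pos_eqI)
      show "W (first_pos (w n) y) = y" using Ww[of "first_pos (w n) y" ?k] nth_first_pos[OF w, of ?k y] foy by simp
      fix j assume "j < first_pos (w n) y"
      then have "w ?k j < y" using less_if_less_first_pos[OF w, of j ?k y] foy by simp
      moreover have "W j = w ?k j" using \<open>j < first_pos (w n) y\<close> by (intro Ww) simp
      ultimately show "W j \<noteq> y" by simp
    qed
  qed
  have Wi: "infinite_parameter_word W"
    unfolding infinite_parameter_word_def
  proof (intro conjI allI impI)
    have "W (first_pos (w y) y) = y" for y
    proof -
      have "W (first_pos (w y) y) = w (max y (first_pos (w y) y)) (first_pos (w y) y)" by (rule Ww) simp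
      also have "first_pos (w y) y = first_pos (w (max y (first_pos (w y) y))) y" using first_pos_stable[of y "max y (first_pos (w y) y)" y] by simp
      finally show ?thesis using nth_first_pos[OF w] first_pos_stable by (metis max.cobounded1 order_refl)
    qed
    then show "surj W" by (rule surjI)
    fix i j assume "j < W i"
    then have "j < w i i" by (simp add: W_def)
    with w[of i] obtain i' where "i' < i" "w i i' = j" by (rule occurs_before)
    then show "\<exists>i'<i. W i' = j" using Ww[of i' i] by auto
  qed
  have W_subst_word: "subst_word W X = subst_word (w n) X" if "first_pos W (length X) \<le> n" for X :: "nat list" and n
  proof -
    have "length X \<le> n" using first_pos_ge[OF Wi, of "length X"] that by simp
    then show ?thesis unfolding subst_word_def using W_fo[of "length X" n] Ww[of _ n] that by simp
  qed
  \<comment> \<open>The property obtained at stage \<open>Suc (length E)\<close> persists: later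
    factors fix the indices up to \<open>length E\<close>, so they leave \<open>E @ [d]\<close> in
    place and merely exchange one tail over \<open>{..d}\<close> for another.\<close>
  have const: "c (subst_word (w n) (E @ d # Z)) = c (subst_word (w n) (E @ d # Z'))"
    if "Suc (length E) \<le> n" "parameter_word d E" "Z \<in> lists {..d}" "Z' \<in> lists {..d}" for E Z Z' n
    using that
  proof (induction n arbitrary: Z Z' rule: dec_induct)
    case base
    have "good (w (length E)) (length E) (V (w (length E)) (length E))" by (rule Vw)
    then show ?case using base unfolding good_def w_simps subst_word_comp[OF w Vi] by blast
  next
    case (step n)
    have fixE: "subst_word (V (w n) n) E = E" by (rule subst_word_initial) (use Vfix step in auto)
    have *: "\<exists>Z'\<in>lists {..d}. subst_word (V (w n) n) (E @ d # Z) = E @ d # Z'" if "Z \<in> lists {..d}" for Z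
    proof -
      obtain Z' where Z': "subst_word (V (w n) n) (E @ d # Z) = subst_word (V (w n) n) E @ d # Z'"
        "set Z' \<subseteq> set (E @ d # Z)"
        by (rule subst_word_append_Cons[OF Vi])
      have "set (E @ d # Z) \<subseteq> {..d}" using that step.prems by (auto simp: parameter_word_def)
      then have "Z' \<in> lists {..d}" using Z'(2) by (meson in_listsI subsetD)
      then show ?thesis using Z'(1) fixE by auto
    qed
    obtain Y where Y: "Y \<in> lists {..d}" "subst_word (V (w n) n) (E @ d # Z) = E @ d # Y" using * step.prems by blast
    obtain Y' where Y': "Y' \<in> lists {..d}" "subst_word (V (w n) n) (E @ d # Z') = E @ d # Y'" using * step.prems by blast
    show ?case unfolding w_simps subst_word_comp[OF w Vi] Y(2) Y'(2)
      by (rule step.IH) (use step.prems Y Y' in auto)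
  qed
  show ?thesis
  proof (rule that[OF Wi])
    fix E Z Z' assume EZ: "parameter_word d E" "Z \<in> lists {..d}" "Z' \<in> lists {..d}"
    \<comment> \<open>Large enough for \<open>W\<close> to agree with \<open>w n\<close> on both
      words and for \<open>E\<close> to have been treated.\<close>
    define n where "n = Suc (length E) + first_pos W (length (E @ d # Z)) + first_pos W (length (E @ d # Z'))"
    have "subst_word W (E @ d # Z) = subst_word (w n) (E @ d # Z)" "subst_word W (E @ d # Z') = subst_word (w n) (E @ d # Z')"
      by (rule W_subst_word, simp add: n_def)+
    then show "c (subst_word W (E @ d # Z)) = c (subst_word W (E @ d # Z'))"
      using const[OF _ EZ, of n] by (simp add: n_def)
  qed
qed

theorem parameter_word_Ramsey:
  fixes c :: "nat list \<Rightarrow> 'c"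
  assumes "finite (c ` {X. parameter_word d X})"
  obtains W where "infinite_parameter_word W"
    "\<And>X Y. parameter_word d X \<Longrightarrow> parameter_word d Y \<Longrightarrow> c (subst_word W X) = c (subst_word W Y)"
  using assms
proof (induction d arbitrary: c thesis)
  case 0
  show ?case by (rule 0(1)[OF infinite_parameter_word_id]) (simp add: parameter_word_0)
next
  case (Suc d)
  obtain W where W: "infinite_parameter_word W"
    "\<And>E Z Z'. parameter_word d E \<Longrightarrow> Z \<in> lists {..d} \<Longrightarrow> Z' \<in> lists {..d} \<Longrightarrow>
      c (subst_word W (E @ d # Z)) = c (subst_word W (E @ d # Z'))"
    by (rule fusion[OF Suc.prems(2)]) blast
  \<comment> \<open>The empty tail represents all tails, so colouring the words with one more
    parameter becomes a colouring of \<open>E\<close> alone.\<close>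
  define c' where "c' E = c (subst_word W (E @ [d]))" for E
  have "c' ` {X. parameter_word d X} \<subseteq> c ` {X. parameter_word (Suc d) X}"
    using parameter_word_subst_word[OF W(1) parameter_word_Suc_append, of d _ "[]"] by (auto simp: c'_def)
  then have "finite (c' ` {X. parameter_word d X})" using Suc.prems(2) by (rule finite_subset)
  then obtain V where V: "infinite_parameter_word V"
    "\<And>X Y. parameter_word d X \<Longrightarrow> parameter_word d Y \<Longrightarrow> c' (subst_word V X) = c' (subst_word V Y)"
    using Suc.IH[of c'] by blast
  \<comment> \<open>Applying \<open>V\<close> to \<open>X\<close> before \<open>W\<close> gives
    \<open>V(E)\<close>, then \<open>d\<close> and some tail; the choice of \<open>W\<close> makes
    the tail irrelevant.\<close>
  have red: "\<exists>E. parameter_word d E \<and> c (subst_word (V \<circ> W) X) = c' (subst_word V E)"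
    if X: "parameter_word (Suc d) X" for X
  proof -
    obtain E Z where X': "X = E @ d # Z" "parameter_word d E" "Z \<in> lists {..d}"
      using X by (rule parameter_word_SucE)
    obtain Z' where Z': "subst_word V X = subst_word V E @ d # Z'" "set Z' \<subseteq> set X"
      unfolding X'(1) by (rule subst_word_append_Cons[OF V(1)])
    have "set X = {..d}" using X by (auto simp: parameter_word_def)
    then have "Z' \<in> lists {..d}" using Z'(2) by auto
    then have "c (subst_word W (subst_word V X)) = c' (subst_word V E)"
      unfolding Z'(1) c'_def
      by (rule W(2)[OF parameter_word_subst_word[OF V(1) X'(2)]]) simp
    then show ?thesis using X'(2) subst_word_comp[OF W(1) V(1)] by metis
  qed
  show ?case
  proof (rule Suc.prems(1))
    show "infinite_parameter_word (V \<circ> W)" using V(1) W(1) by (intro infinite_parameter_word_comp)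
  next
    fix X Y assume X: "parameter_word (Suc d) X" and Y: "parameter_word (Suc d) Y"
    show "c (subst_word (V \<circ> W) X) = c (subst_word (V \<circ> W) Y)"
      using red[OF X] red[OF Y] V(2) by metis
  qed
qed

text \<open>The numbers of parameters are treated one after the other. Constancy obtained for
  smaller numbers survives a further substitution, which maps \<open>d\<close>-parameter words to
  \<open>d\<close>-parameter words.\<close>

theorem parameter_word_Ramsey_upto:
  fixes c :: "nat list \<Rightarrow> 'c"
  assumes "finite (c ` {X. \<exists>d\<le>D. parameter_word d X})"
  obtains W where "infinite_parameter_word W"
    "\<And>d X Y. d \<le> D \<Longrightarrow> parameter_word d X \<Longrightarrow> parameter_word d Y \<Longrightarrow> c (subst_word W X) = c (subst_word W Y)"
  using assms
proof (induction D arbitrary: c thesis)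
  case 0
  show ?case by (rule 0(1)[OF infinite_parameter_word_id]) (simp add: parameter_word_0)
next
  case (Suc D)
  obtain W where W: "infinite_parameter_word W"
    "\<And>d X Y. d \<le> D \<Longrightarrow> parameter_word d X \<Longrightarrow> parameter_word d Y \<Longrightarrow> c (subst_word W X) = c (subst_word W Y)"
  proof (rule Suc.IH)
    show "finite (c ` {X. \<exists>d\<le>D. parameter_word d X})"
      by (rule finite_subset[OF _ Suc.prems(2)]) (auto intro: le_SucI)
  qed blast
  have "(\<lambda>X. c (subst_word W X)) ` {X. parameter_word (Suc D) X} \<subseteq> c ` {X. \<exists>d\<le>Suc D. parameter_word d X}"
    using parameter_word_subst_word[OF W(1)] by blast
  then have "finite ((\<lambda>X. c (subst_word W X)) ` {X. parameter_word (Suc D) X})"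
    using Suc.prems(2) by (rule finite_subset)
  then obtain V where V: "infinite_parameter_word V"
    "\<And>X Y. parameter_word (Suc D) X \<Longrightarrow> parameter_word (Suc D) Y \<Longrightarrow>
      c (subst_word W (subst_word V X)) = c (subst_word W (subst_word V Y))"
    by (rule parameter_word_Ramsey) blast
  show ?case
  proof (rule Suc.prems(1))
    show "infinite_parameter_word (V \<circ> W)" using V(1) W(1) by (intro infinite_parameter_word_comp)
  next
    fix d X Y assume d: "d \<le> Suc D" and XY: "parameter_word d X" "parameter_word d Y"
    have "c (subst_word W (subst_word V X)) = c (subst_word W (subst_word V Y))"
    proof (cases "d = Suc D")
      case True
      then show ?thesis using V(2) XY by blast
    next
      case False
      then have "d \<le> D" using d by simp
      then show ?thesis using parameter_word_subst_word[OF V(1)] XY by (intro W(2))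
    qed
    then show "c (subst_word (V \<circ> W) X) = c (subst_word (V \<circ> W) Y)" unfolding subst_word_comp[OF W(1) V(1)] .
  qed
qed


section \<open>Embedding types\<close>

lemma nths_eq_map_filter: "nths X F = map ((!) X) (filter (\<lambda>i. i \<in> F) [0..<length X])"
proof -
  have "zip X [0..<length X] = map (\<lambda>i. (X ! i, i)) [0..<length X]"
    by (rule nth_equalityI) auto
  then show ?thesis by (simp add: nths_def filter_map o_def)
qed

lemma nths_eqI:
  assumes "sorted_wrt (<) qs" "set qs = F \<inter> {..<length X}"
  shows "nths X F = map ((!) X) qs"
proof -
  have "filter (\<lambda>i. i \<in> F) [0..<length X] = qs"
    by (rule sorted_distinct_set_unique)
      (use assms in \<open>auto simp: strict_sorted_iff sorted_wrt_filter\<close>)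
  then show ?thesis by (simp add: nths_eq_map_filter)
qed

text \<open>With this default, \<open>first_occ W d\<close> is \<open>length W\<close> for a
  \<open>d\<close>-parameter word \<open>W\<close>, so words \<open>U\<close> of full length
  \<open>d\<close>, where nothing is truncated, need no separate treatment.\<close>

lemma first_occ_absent: "i \<notin> set W \<Longrightarrow> first_occ W i = length W"
  unfolding first_occ_def by (induction W) auto

lemma first_occ_strict:
  assumes W: "parameter_word d W" and "i < j" "j \<le> d"
  shows "first_occ W i < first_occ W j"
proof (cases "j = d")
  case True
  then have "j \<notin> set W" using W by (simp add: parameter_word_def)
  then show ?thesis using first_occ_less[of i W] assms by (simp add: first_occ_absent parameter_word_def)
next
  case False
  then have j: "j \<in> set W" using assms by (auto simp: parameter_word_def)
  have "i < W ! first_occ W j" using assms(2) nth_first_occ[OF j] by simp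
  then obtain p where "p < first_occ W j" "W ! p = i"
    using W first_occ_less[OF j] unfolding parameter_word_iff by blast
  then show ?thesis using first_occ_le[of p W i] first_occ_less[OF j] by simp
qed

lemma nth_less_if_first_occ:
  assumes W: "parameter_word d W" and "e \<le> d" "i < first_occ W e"
  shows "i < length W" "W ! i < e"
proof -
  have "first_occ W e \<le> length W" by (simp add: first_occ_def length_takeWhile_le)
  then show i: "i < length W" using assms(3) by simp
  show "W ! i < e"
  proof (rule ccontr)
    assume "\<not> W ! i < e"
    moreover have "W ! i < d" using W i nth_mem by (auto simp: parameter_word_def)
    ultimately have "first_occ W e \<le> first_occ W (W ! i)"
      using first_occ_strict[OF W, of e "W ! i"] by (cases "e = W ! i") auto
    then show False using first_occ_le[OF i refl] assms(3) by simp
  qed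
qed

lemma length_param_subst [simp]: "length (param_subst W U) = first_occ W (length U)"
  by (simp add: param_subst_def first_occ_def)

lemma nth_param_subst: "i < first_occ W (length U) \<Longrightarrow> param_subst W U ! i = U ! (W ! i)"
  by (simp add: param_subst_def first_occ_def takeWhile_nth)

text \<open>\<open>U\<close> is recovered from \<open>W(U)\<close> by reading it at the first
  occurrences of the parameters; those of index at least \<open>length U\<close> lie beyond the end
  of \<open>W(U)\<close>. Hence \<open>W\<close> and \<open>S\<close> determine the embedding
  type.\<close>

lemma nths_param_subst:
  assumes W: "parameter_word d W" and "length U \<le> d"
  shows "nths (param_subst W U) (first_occ W ` {..<d}) = U"
proof -
  have "nths (param_subst W U) (first_occ W ` {..<d}) =
      map ((!) (param_subst W U)) (map (first_occ W) [0..<length U])"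
  proof (rule nths_eqI)
    show "sorted_wrt (<) (map (first_occ W) [0..<length U])"
      unfolding sorted_wrt_map
      by (rule sorted_wrt_mono_rel[OF _ sorted_wrt_upt]) (use first_occ_strict[OF W] assms(2) in auto)
    have "first_occ W i < first_occ W (length U) \<longleftrightarrow> i < length U" if "i < d" for i
      using first_occ_strict[OF W] assms(2) that
      by (metis leD leI le_eq_less_or_eq less_imp_le order_less_irrefl)
    then show "set (map (first_occ W) [0..<length U]) =
        first_occ W ` {..<d} \<inter> {..<length (param_subst W U)}"
      using assms(2) by auto
  qed
  also have "\<dots> = U"
  proof (rule nth_equalityI)
    fix i assume "i < length (map ((!) (param_subst W U)) (map (first_occ W) [0..<length U]))"
    then have i: "i < length U" by simp
    then have "i \<in> set W" using W assms(2) by (auto simp: parameter_word_def)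
    then show "map ((!) (param_subst W U)) (map (first_occ W) [0..<length U]) ! i = U ! i"
      using i first_occ_strict[OF W i assms(2)] nth_first_occ by (simp add: nth_param_subst)
  qed simp
  finally show ?thesis .
qed

text \<open>The preimage is \<open>V\<close> read at the first occurrences of the parameters below
  \<open>e\<close>.\<close>

lemma param_subst_exists:
  assumes W: "parameter_word d W" and e: "e \<le> d" "length V = first_occ W e"
    and V: "\<And>i. i < length V \<Longrightarrow> V ! i = V ! first_occ W (W ! i)"
  shows "\<exists>U. set U \<subseteq> set V \<and> length U \<le> d \<and> param_subst W U = V"
proof (intro exI conjI)
  let ?U = "map (\<lambda>k. V ! first_occ W k) [0..<e]"
  show "set ?U \<subseteq> set V"
    using first_occ_strict[OF W] e by (auto intro!: nth_mem)
  show "length ?U \<le> d" using e by simp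
  show "param_subst W ?U = V"
  proof (rule nth_equalityI)
    show "length (param_subst W ?U) = length V" using e by simp
    fix i assume i: "i < length (param_subst W ?U)"
    then have "i < first_occ W e" by simp
    then show "param_subst W ?U ! i = V ! i"
      using nth_less_if_first_occ[OF W e(1)] V[of i] e(2) by (simp add: nth_param_subst)
  qed
qed

text \<open>The positions that must be first occurrences of parameters in every envelope of \<open>S\<close>.\<close>

definition breaks :: "'a list set \<Rightarrow> nat set" where
  "breaks S = {i. (\<exists>V\<in>S. i < length V) \<and>
     ((\<exists>V\<in>S. length V = i) \<or> (\<forall>j<i. \<exists>V\<in>S. i < length V \<and> V ! i \<noteq> V ! j))}"

text \<open>At the length of a member, truncation happens just before the first occurrence of a
  parameter, and a longer member shows that this parameter does occur in \<open>W\<close>. At any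
  other break, an earlier occurrence of the same parameter would produce an earlier column with
  equal entries.\<close>

lemma breaks_subset_first_occ:
  assumes "envelope \<Sigma> d W S"
  shows "breaks S \<subseteq> first_occ W ` {..<d}"
proof
  obtain S' where W: "parameter_word d W" and S': "\<forall>U\<in>S'. length U \<le> d" "param_subst W ` S' = S"
    using assms by (auto simp: envelope_def is_embedding_type_def)
  fix i assume i: "i \<in> breaks S"
  then obtain U where U: "U \<in> S'" "i < first_occ W (length U)"
    unfolding breaks_def S'(2)[symmetric] by auto
  then have iW: "i < length W" "W ! i < d"
    using nth_less_if_first_occ[OF W] S'(1) by (metis order_less_le_trans)+
  show "i \<in> first_occ W ` {..<d}"
  proof (cases "\<exists>V\<in>S. length V = i")
    case True
    then obtain U' where U': "U' \<in> S'" "first_occ W (length U') = i" using S'(2) by auto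
    have "length U' \<noteq> d" using iW U' W first_occ_absent[of d W] by (auto simp: parameter_word_def)
    then have "length U' < d" using S'(1) U'(1) by (simp add: order_less_le)
    then show ?thesis using U'(2) by auto
  next
    case False
    have "first_occ W (W ! i) = i"
    proof (rule ccontr)
      assume "first_occ W (W ! i) \<noteq> i"
      then have less: "first_occ W (W ! i) < i" using first_occ_le[OF iW(1) refl] by simp
      then obtain V where V: "V \<in> S" "i < length V" "V ! i \<noteq> V ! first_occ W (W ! i)"
        using False i unfolding breaks_def by blast
      then obtain U' where "V = param_subst W U'" using S'(2) by blast
      then show False using V less nth_first_occ[of "W ! i" W] iW(1) by (simp add: nth_param_subst)
    qed
    then show ?thesis using iW by (metis imageI lessThan_iff)
  qed
qed

lemma finite_breaks:
  assumes "finite S"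
  shows "finite (breaks S)"
proof (rule finite_subset)
  show "breaks S \<subseteq> (\<Union>V\<in>S. {..<length V})" by (auto simp: breaks_def)
qed (use assms in simp)

lemma card_below_mono:
  assumes "finite B" "b \<in> B" "b < (c :: nat)"
  shows "card (B \<inter> {..<b}) < card (B \<inter> {..<c})"
  by (rule psubset_card_mono) (use assms in auto)

lemma card_below_image:
  assumes "finite (B :: nat set)"
  shows "(\<lambda>b. card (B \<inter> {..<b})) ` B = {..<card B}"
proof (rule card_subset_eq)
  show "(\<lambda>b. card (B \<inter> {..<b})) ` B \<subseteq> {..<card B}"
    using assms by (auto intro!: psubset_card_mono)
  have "inj_on (\<lambda>b. card (B \<inter> {..<b})) B"
    by (rule inj_onI) (metis assms card_below_mono less_irrefl linorder_neqE_nat)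
  then show "card ((\<lambda>b. card (B \<inter> {..<b})) ` B) = card {..<card B}"
    by (simp add: card_image)
qed simp

text \<open>A position that is not a break repeats an earlier column in all words that reach it;
  going back repeatedly ends at a break.\<close>

lemma breaks_representative:
  assumes "V0 \<in> S" "i < length V0"
  shows "\<exists>r\<in>breaks S. r \<le> i \<and> (\<forall>V\<in>S. i < length V \<longrightarrow> V ! i = V ! r)"
  using assms(2)
proof (induction i rule: less_induct)
  case (less i)
  show ?case
  proof (cases "i \<in> breaks S")
    case True then show ?thesis by auto
  next
    case False
    then obtain j where j: "j < i" "\<forall>V\<in>S. i < length V \<longrightarrow> V ! i = V ! j"
      using assms(1) less.prems unfolding breaks_def by blast
    then obtain r where "r \<in> breaks S" "r \<le> j" "\<forall>V\<in>S. j < length V \<longrightarrow> V ! j = V ! r"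
      using less.IH[of j] less.prems by auto
    then show ?thesis using j by (intro bexI[of _ r]) auto
  qed
qed

text \<open>The lower bound given by the breaks is attained by a word as long as the longest member
  of \<open>S\<close>, in which every position carries the number of a break with the same
  column.\<close>

lemma breaks_envelope:
  assumes S: "finite S" "S \<subseteq> lists \<Sigma>" and V0: "V0 \<in> S" "V0 \<noteq> []"
  shows "\<exists>W. envelope \<Sigma> (card (breaks S)) W S"
proof -
  define B where "B = breaks S"
  define d where "d = card B"
  define M where "M = Max (length ` S)"
  \<comment> \<open>The increasing numbering of the breaks; on a break it is the index of the
    parameter that starts there.\<close>
  define ind where "ind x = card (B \<inter> {..<x})" for x
  have fB: "finite B" using finite_breaks[OF S(1)] by (simp add: B_def)
  have M_le: "length V \<le> M" if "V \<in> S" for V using that S(1) by (simp add: M_def)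
  have "M \<in> length ` S" unfolding M_def by (rule Max_in) (use S(1) V0 in auto)
  then obtain V1 where V1: "V1 \<in> S" "length V1 = M" by auto
  have BM: "b < M" if "b \<in> B" for b
    using that M_le unfolding B_def breaks_def by (auto intro: less_le_trans)
  have "\<exists>r\<in>B. r \<le> i \<and> (\<forall>V\<in>S. i < length V \<longrightarrow> V ! i = V ! r)" if "i < M" for i
    using breaks_representative[OF V1(1), of i] that V1(2) by (simp add: B_def)
  then have "\<exists>r. i < M \<longrightarrow> r \<in> B \<and> r \<le> i \<and> (\<forall>V\<in>S. i < length V \<longrightarrow> V ! i = V ! r) \<and> (i \<in> B \<longrightarrow> r = i)" for i
    by (cases "i \<in> B") auto
  then have "\<forall>i. \<exists>r. i < M \<longrightarrow> r \<in> B \<and> r \<le> i \<and> (\<forall>V\<in>S. i < length V \<longrightarrow> V ! i = V ! r) \<and> (i \<in> B \<longrightarrow> r = i)"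
    by blast
  from choice[OF this] obtain rep where
    rep: "\<forall>i<M. rep i \<in> B \<and> rep i \<le> i \<and> (\<forall>V\<in>S. i < length V \<longrightarrow> V ! i = V ! rep i) \<and> (i \<in> B \<longrightarrow> rep i = i)"
    by blast
  have ind_mono: "ind b < ind c" if "b \<in> B" "b < c" for b c
    unfolding ind_def by (rule card_below_mono[OF fB that])
  have ind_image: "ind ` B = {..<d}"
    using card_below_image[OF fB] by (simp add: ind_def d_def)
  define W where "W = map (\<lambda>i. ind (rep i)) [0..<M]"
  have Wn: "W ! i = ind (rep i)" if "i < M" for i using that by (simp add: W_def)
  have WB: "W ! b = ind b" if "b \<in> B" for b using that rep BM Wn by auto
  have first: "first_occ W (ind b) = b" if b: "b \<in> B" for b
  proof (rule first_occ_eqI)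
    show "b < length W" using BM b by (simp add: W_def)
    show "W ! b = ind b" by (rule WB[OF b])
    fix j assume j: "j < b"
    then have "j < M" using BM[OF b] by simp
    then have "ind (rep j) < ind b" using rep j by (intro ind_mono) (auto intro: le_less_trans)
    then show "W ! j \<noteq> ind b" using Wn[OF \<open>j < M\<close>] by simp
  qed
  have W: "parameter_word d W"
    unfolding parameter_word_iff
  proof (intro conjI allI impI)
    have "rep ` {..<M} = B"
    proof
      show "rep ` {..<M} \<subseteq> B" using rep by blast
      show "B \<subseteq> rep ` {..<M}"
      proof
        fix b assume "b \<in> B"
        then have "b < M" "rep b = b" using rep BM by blast+
        then show "b \<in> rep ` {..<M}" by (metis imageI lessThan_iff)
      qed
    qed
    then have "ind ` rep ` {..<M} = {..<d}" using ind_image by simp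
    then show "set W = {..<d}" by (simp add: W_def image_image lessThan_atLeast0)
    fix i j assume "i < length W" "j < W ! i"
    then have i: "i < M" and j: "j < ind (rep i)" using Wn by (auto simp: W_def)
    have "ind (rep i) < d" using ind_image rep i by auto
    then have "j \<in> ind ` B" using j ind_image by simp
    then obtain b where b: "b \<in> B" "ind b = j" by auto
    have "b < rep i"
    proof (rule ccontr)
      assume "\<not> b < rep i"
      then have "ind (rep i) \<le> ind b"
        using ind_mono[of "rep i" b] rep i by (cases "rep i = b") auto
      then show False using j b by simp
    qed
    then have "b < i" using rep i by (meson less_le_trans)
    then show "\<exists>i'<i. W ! i' = j" using WB[OF b(1)] b(2) by auto
  qed
  \<comment> \<open>A member shorter than the longest one ends at a break. A longest one ends at
    \<open>M\<close>, beyond all breaks, where \<open>ind M = d\<close> and nothing is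
    truncated.\<close>
  have ex: "\<exists>U. set U \<subseteq> set V \<and> length U \<le> d \<and> param_subst W U = V" if V: "V \<in> S" for V
  proof (rule param_subst_exists[OF W])
    show "ind (length V) \<le> d" unfolding ind_def d_def by (rule card_mono[OF fB]) auto
    show "length V = first_occ W (ind (length V))"
    proof (cases "length V = M")
      case True
      have "B \<inter> {..<M} = B" using BM by auto
      then have "ind M = d" by (simp add: ind_def d_def)
      moreover have "d \<notin> set W" using W by (simp add: parameter_word_def)
      ultimately show ?thesis using True by (simp add: first_occ_absent W_def)
    next
      case False
      then have "length V < length V1" using M_le[OF V] V1(2) by simp
      then have "length V \<in> B" using V V1(1) unfolding B_def breaks_def by blast
      then show ?thesis by (simp add: first)
    qed
    fix i assume i: "i < length V"
    then have iM: "i < M" using M_le[OF V] by simp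
    then have "first_occ W (W ! i) = rep i" using first rep Wn by simp
    then show "V ! i = V ! first_occ W (W ! i)" using rep iM V i by simp
  qed
  define S' where "S' = {U. set U \<subseteq> \<Sigma> \<and> length U \<le> d \<and> param_subst W U \<in> S}"
  have "param_subst W ` S' = S"
  proof
    show "S \<subseteq> param_subst W ` S'"
    proof
      fix V assume V: "V \<in> S"
      then obtain U where "set U \<subseteq> set V" "length U \<le> d" "param_subst W U = V" using ex by blast
      moreover have "set V \<subseteq> \<Sigma>" using V S(2) by auto
      ultimately show "V \<in> param_subst W ` S'" using V unfolding S'_def by blast
    qed
  qed (auto simp: S'_def)
  then have "is_embedding_type \<Sigma> d W S S'" by (auto simp: is_embedding_type_def S'_def)
  \<comment> \<open>Position \<open>0\<close> has no earlier column, so a nonempty member of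
    \<open>S\<close> makes it a break; this yields the positive number of parameters required of an
    envelope.\<close>
  moreover have "0 \<in> B" using V0 by (auto simp: B_def breaks_def)
  then have "d > 0" using fB by (auto simp: d_def card_gt_0_iff)
  moreover have "d \<le> length W"
    using card_length[of W] W by (simp add: parameter_word_def)
  ultimately show ?thesis using W unfolding d_def B_def envelope_def by blast
qed

section \<open>Minimal envelopes and the embedding type\<close>

lemma is_embedding_type_unique:
  assumes "parameter_word d W" "is_embedding_type \<Sigma> d W S S'"
  shows "S' = (\<lambda>V. nths V (first_occ W ` {..<d})) ` S"
proof -
  have "\<forall>U\<in>S'. length U \<le> d" and S: "param_subst W ` S' = S"
    using assms(2) by (simp_all add: is_embedding_type_def)
  then have "(\<lambda>U. nths (param_subst W U) (first_occ W ` {..<d})) ` S' = (\<lambda>U. U) ` S'"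
    by (intro image_cong refl nths_param_subst[OF assms(1)]) blast
  then show ?thesis unfolding S[symmetric] image_image by simp
qed

text \<open>The breaks are among the at most \<open>d\<close> first occurrences, and minimality
  gives \<open>d \<le> card (breaks S)\<close>. So the two sets coincide, and the type is
  \<open>S\<close> read at its breaks.\<close>

lemma minimal_envelope_breaks:
  assumes S: "finite S" "S \<subseteq> lists \<Sigma>" and V0: "V0 \<in> S" "V0 \<noteq> []"
    and W: "minimal_envelope \<Sigma> d W S"
  shows "d = card (breaks S)" "first_occ W ` {..<d} = breaks S"
    "embedding_type \<Sigma> d W S = (\<lambda>V. nths V (breaks S)) ` S"
    "is_embedding_type \<Sigma> d W S (embedding_type \<Sigma> d W S)"
proof -
  have env: "envelope \<Sigma> d W S" using W by (simp add: minimal_envelope_def)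
  have sub: "breaks S \<subseteq> first_occ W ` {..<d}" by (rule breaks_subset_first_occ[OF env])
  have c: "card (first_occ W ` {..<d}) \<le> d" using card_image_le[of "{..<d}" "first_occ W"] by simp
  have "d \<le> card (breaks S)"
    using W breaks_envelope[OF S V0] unfolding minimal_envelope_def by blast
  moreover have "card (breaks S) \<le> card (first_occ W ` {..<d})" by (rule card_mono[OF _ sub]) simp
  ultimately show d: "d = card (breaks S)" using c by simp
  show F: "first_occ W ` {..<d} = breaks S"
    by (rule card_seteq[symmetric]) (use sub c d in auto)
  obtain S' where pw: "parameter_word d W" and S': "is_embedding_type \<Sigma> d W S S'"
    using env by (auto simp: envelope_def)
  have "embedding_type \<Sigma> d W S = S'"
    unfolding embedding_type_def
    using is_embedding_type_unique[OF pw] S' by (intro the_equality) blast+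
  then show "embedding_type \<Sigma> d W S = (\<lambda>V. nths V (breaks S)) ` S"
    "is_embedding_type \<Sigma> d W S (embedding_type \<Sigma> d W S)"
    using is_embedding_type_unique[OF pw S'] S' F by simp_all
qed

lemma minimal_envelope_exists:
  assumes "finite S" "S \<subseteq> lists \<Sigma>" "V0 \<in> S" "V0 \<noteq> []"
  obtains W where "minimal_envelope \<Sigma> (card (breaks S)) W S"
proof -
  obtain W where "envelope \<Sigma> (card (breaks S)) W S" using breaks_envelope[OF assms] by blast
  moreover have "card (breaks S) \<le> d'" if "envelope \<Sigma> d' W' S" for d' W'
    using card_mono[OF _ breaks_subset_first_occ[OF that]] card_image_le[of "{..<d'}" "first_occ W'"]
    by fastforce
  ultimately show ?thesis using that unfolding minimal_envelope_def by blast
qed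

text \<open>Replaces the choice of a minimal envelope by a formula in \<open>S\<close>
  alone.\<close>

lemma tau_eq:
  assumes "finite S" "S \<subseteq> lists \<Sigma>" "V0 \<in> S" "V0 \<noteq> []"
  shows "tau \<Sigma> S = (\<lambda>V. nths V (breaks S)) ` S"
proof -
  obtain W where "minimal_envelope \<Sigma> (card (breaks S)) W S"
    using minimal_envelope_exists[OF assms] .
  then have "\<exists>d W. minimal_envelope \<Sigma> d W S \<and> tau \<Sigma> S = embedding_type \<Sigma> d W S"
    unfolding tau_def by (rule_tac someI_ex) blast
  then show ?thesis using minimal_envelope_breaks(3)[OF assms] by metis
qed

lemma tau_envelope:
  assumes "finite S" "S \<subseteq> lists \<Sigma>" "V0 \<in> S" "V0 \<noteq> []"
  obtains W where "parameter_word (card (breaks S)) W" "param_subst W ` tau \<Sigma> S = S"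
    "tau \<Sigma> S \<subseteq> lists \<Sigma>" "\<And>U. U \<in> tau \<Sigma> S \<Longrightarrow> length U \<le> card (breaks S)"
proof -
  obtain W where W: "minimal_envelope \<Sigma> (card (breaks S)) W S"
    using minimal_envelope_exists[OF assms] .
  have "embedding_type \<Sigma> (card (breaks S)) W S = tau \<Sigma> S"
    using minimal_envelope_breaks(3)[OF assms W] tau_eq[OF assms] by simp
  then have "is_embedding_type \<Sigma> (card (breaks S)) W S (tau \<Sigma> S)"
    using minimal_envelope_breaks(4)[OF assms W] by simp
  moreover have "parameter_word (card (breaks S)) W"
    using W by (simp add: minimal_envelope_def envelope_def)
  ultimately show ?thesis using that unfolding is_embedding_type_def by blast
qed

text \<open>All breaks lie below the length of a longest member, which therefore contributes one
  letter per break to the type. So sets of equal type have minimal envelopes with equally many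
  parameters.\<close>

lemma card_breaks_eq_Max:
  assumes "finite S" "S \<subseteq> lists \<Sigma>" "V0 \<in> S" "V0 \<noteq> []"
  shows "card (breaks S) = Max (length ` tau \<Sigma> S)"
proof -
  have len: "length (nths V (breaks S)) = card (breaks S \<inter> {..<length V})" for V
    by (simp add: length_nths Int_def conj_commute)
  have "Max (length ` S) \<in> length ` S" by (rule Max_in) (use assms in auto)
  then obtain V1 where V1: "V1 \<in> S" "length V1 = Max (length ` S)" by auto
  have "length V \<le> length V1" if "V \<in> S" for V using that assms(1) by (simp add: V1(2))
  then have "breaks S \<inter> {..<length V1} = breaks S" by (fastforce simp: breaks_def)
  then have "length (nths V1 (breaks S)) = card (breaks S)" by (simp add: len)
  then have "card (breaks S) \<in> length ` tau \<Sigma> S"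
    using V1(1) unfolding tau_eq[OF assms] image_image by (metis image_eqI)
  moreover have "l \<le> card (breaks S)" if "l \<in> length ` tau \<Sigma> S" for l
    using that unfolding tau_eq[OF assms] image_image len
    by (auto intro!: card_mono finite_breaks assms(1))
  moreover have "finite (length ` tau \<Sigma> S)" using assms(1) unfolding tau_eq[OF assms] by simp
  ultimately show ?thesis by (intro Max_eqI[symmetric]) auto
qed

section \<open>Embedding types under substitution\<close>

text \<open>Column \<open>p\<close> of the image is column \<open>V p\<close> of \<open>S\<close>. A
  break of the image must be the first occurrence of its value, since otherwise its column appears
  earlier, and lengths are mapped by \<open>first_pos V\<close>.\<close>

lemma breaks_subst_word:
  assumes V: "infinite_parameter_word V"
  shows "breaks (subst_word V ` S) = first_pos V ` breaks S"
proof (intro equalityI subsetI)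
  fix p assume p: "p \<in> breaks (subst_word V ` S)"
  have less: "V q < length X" if "q < first_pos V (length X)" for q and X :: "'a list"
    by (rule less_if_less_first_pos[OF V that])
  obtain X0 where X0: "X0 \<in> S" "p < first_pos V (length X0)" using p by (auto simp: breaks_def)
  have "first_pos V (V p) = p"
  proof (cases "\<exists>X\<in>S. first_pos V (length X) = p")
    case True
    then show ?thesis using nth_first_pos[OF V] by auto
  next
    case False
    show ?thesis
    proof (rule ccontr)
      assume "first_pos V (V p) \<noteq> p"
      then have "first_pos V (V p) < p" using first_pos_least[of V p "V p"] by simp
      then obtain X where "X \<in> S" "p < first_pos V (length X)" "subst_word V X ! p \<noteq> subst_word V X ! first_pos V (V p)"
        using p False unfolding breaks_def by auto
      then show False using \<open>first_pos V (V p) < p\<close> nth_first_pos[OF V] by (simp add: nth_subst_word)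
    qed
  qed
  moreover have "V p \<in> breaks S"
  proof (cases "\<exists>X\<in>S. first_pos V (length X) = p")
    case True
    then have "\<exists>X\<in>S. length X = V p" using nth_first_pos[OF V] by auto
    then show ?thesis using X0 less by (auto simp: breaks_def)
  next
    case False
    have "\<exists>X\<in>S. V p < length X \<and> X ! V p \<noteq> X ! j" if "j < V p" for j
    proof -
      from V that obtain q where q: "q < p" "V q = j" by (rule occurs_before)
      then obtain X where X: "X \<in> S" "p < first_pos V (length X)" "subst_word V X ! p \<noteq> subst_word V X ! q"
        using p False unfolding breaks_def by auto
      then have "X ! V p \<noteq> X ! j" using q by (simp add: nth_subst_word)
      then show ?thesis using X less by blast
    qed
    then show ?thesis using X0 less by (auto simp: breaks_def)
  qed
  ultimately show "p \<in> first_pos V ` breaks S" by (metis imageI)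
next
  fix p assume "p \<in> first_pos V ` breaks S"
  then obtain b where b: "b \<in> breaks S" "p = first_pos V b" by blast
  then obtain X0 where X0: "X0 \<in> S" "b < length X0" by (auto simp: breaks_def)
  then have long: "\<exists>Y\<in>subst_word V ` S. p < length Y" using b(2) first_pos_less_iff[OF V] by auto
  show "p \<in> breaks (subst_word V ` S)"
  proof (cases "\<exists>X\<in>S. length X = b")
    case True
    then have "\<exists>Y\<in>subst_word V ` S. length Y = p" using b(2) by auto
    then show ?thesis using long by (simp add: breaks_def)
  next
    case False
    have "\<exists>Y\<in>subst_word V ` S. p < length Y \<and> Y ! p \<noteq> Y ! q" if "q < p" for q
    proof -
      have "V q < b" using less_if_less_first_pos[OF V] that b(2) by simp
      then obtain X where X: "X \<in> S" "b < length X" "X ! b \<noteq> X ! V q"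
        using b(1) False unfolding breaks_def by blast
      then have "p < first_pos V (length X)" using b(2) first_pos_less_iff[OF V] by simp
      moreover from this have "subst_word V X ! p \<noteq> subst_word V X ! q"
        using X that nth_first_pos[OF V] b(2) by (simp add: nth_subst_word)
      ultimately show ?thesis using X(1) by auto
    qed
    then show ?thesis using long by (simp add: breaks_def)
  qed
qed

lemma nths_subst_word:
  assumes V: "infinite_parameter_word V"
  shows "nths (subst_word V X) (first_pos V ` B) = nths X B"
proof -
  let ?qs = "filter (\<lambda>i. i \<in> B) [0..<length X]"
  have "nths (subst_word V X) (first_pos V ` B) = map ((!) (subst_word V X)) (map (first_pos V) ?qs)"
  proof (rule nths_eqI)
    have "sorted_wrt (<) ?qs" by (intro sorted_wrt_filter sorted_wrt_upt)
    then show "sorted_wrt (<) (map (first_pos V) ?qs)"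
      by (simp add: sorted_wrt_map first_pos_less_iff[OF V])
    show "set (map (first_pos V) ?qs) = first_pos V ` B \<inter> {..<length (subst_word V X)}"
      by (auto simp: first_pos_less_iff[OF V])
  qed
  also have "\<dots> = map ((!) X) ?qs"
    by (simp add: nth_subst_word first_pos_less_iff[OF V] nth_first_pos[OF V])
  finally show ?thesis by (simp add: nths_eq_map_filter)
qed

lemma tau_subst_word:
  assumes V: "infinite_parameter_word V" and S: "finite S" "S \<subseteq> lists \<Sigma>" "V0 \<in> S" "V0 \<noteq> []"
  shows "tau \<Sigma> (subst_word V ` S) = tau \<Sigma> S"
proof -
  have "first_pos V 0 < first_pos V (length V0)" using S(4) by (simp add: first_pos_less_iff[OF V])
  then have ne: "subst_word V V0 \<noteq> []" by (metis length_subst_word list.size(3) not_less_zero)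
  have sub: "subst_word V ` S \<subseteq> lists \<Sigma>"
  proof
    fix Y assume "Y \<in> subst_word V ` S"
    then obtain X where "X \<in> S" "Y = subst_word V X" by blast
    then show "Y \<in> lists \<Sigma>" using set_subst_word_subset[OF V, of X] S(2) by auto
  qed
  have "tau \<Sigma> (subst_word V ` S) = (\<lambda>Y. nths Y (breaks (subst_word V ` S))) ` subst_word V ` S"
    by (rule tau_eq[OF _ sub imageI ne]) (use S in auto)
  also have "\<dots> = (\<lambda>X. nths X (breaks S)) ` S"
    unfolding image_image breaks_subst_word[OF V] nths_subst_word[OF V] ..
  finally show ?thesis by (simp only: tau_eq[OF S])
qed

lemma first_occ_subst_word:
  assumes V: "infinite_parameter_word V" and W: "parameter_word d W" and "e \<le> d"
  shows "first_occ (subst_word V W) e = first_pos V (first_occ W e)"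
proof (cases "e = d")
  case True
  then have "e \<notin> set W" "e \<notin> set (subst_word V W)"
    using W parameter_word_subst_word[OF V W] by (auto simp: parameter_word_def)
  then show ?thesis by (simp add: first_occ_absent)
next
  case False
  then have e: "e \<in> set W" using W assms(3) by (auto simp: parameter_word_def)
  have less: "first_pos V (first_occ W e) < first_pos V (length W)"
    using first_occ_less[OF e] by (simp add: first_pos_less_iff[OF V])
  show ?thesis
  proof (rule first_occ_eqI)
    show "first_pos V (first_occ W e) < length (subst_word V W)" using less by simp
    show "subst_word V W ! first_pos V (first_occ W e) = e"
      using less nth_first_occ[OF e] by (simp add: nth_subst_word nth_first_pos[OF V])
    fix j assume j: "j < first_pos V (first_occ W e)"
    then have "V j < first_occ W e" by (rule less_if_less_first_pos[OF V])
    then have "W ! V j < e" by (rule nth_less_if_first_occ(2)[OF W assms(3)])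
    then show "subst_word V W ! j \<noteq> e" using j less by (simp add: nth_subst_word)
  qed
qed

text \<open>Associativity of substitution: \<open>(V(W))(U) = V(W(U))\<close>. The two truncations
  agree by \<open>first_occ_subst_word\<close>.\<close>

lemma param_subst_subst_word:
  assumes V: "infinite_parameter_word V" and W: "parameter_word d W" and U: "length U \<le> d"
  shows "param_subst (subst_word V W) U = subst_word V (param_subst W U)"
proof (rule nth_equalityI)
  show "length (param_subst (subst_word V W) U) = length (subst_word V (param_subst W U))"
    using first_occ_subst_word[OF V W U] by simp
  fix i assume i0: "i < length (param_subst (subst_word V W) U)"
  then have i: "i < first_pos V (first_occ W (length U))" using first_occ_subst_word[OF V W U] by simp
  then have Vi: "V i < first_occ W (length U)" by (rule less_if_less_first_pos[OF V])
  then have "V i < length W" by (rule nth_less_if_first_occ(1)[OF W U])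
  have "i < first_pos V (length W)"
  proof (rule ccontr)
    assume "\<not> i < first_pos V (length W)"
    then have "first_pos V (length W) < first_pos V (first_occ W (length U))" using i by simp
    then have "length W < first_occ W (length U)" by (simp add: first_pos_less_iff[OF V])
    then show False by (simp add: first_occ_def length_takeWhile_le leD)
  qed
  then show "param_subst (subst_word V W) U ! i = subst_word V (param_subst W U) ! i"
    using i0 i Vi by (simp add: nth_param_subst nth_subst_word)
qed

text \<open>At most \<open>card S\<close> breaks are lengths of members. Each remaining break has a
  column different from all earlier ones; with \<open>None\<close> for words that have already
  ended, columns are functions from \<open>S\<close> to a set of \<open>Suc (card \<Sigma>)\<close>
  values.\<close>

lemma card_breaks_le:
  assumes S: "finite S" "S \<subseteq> lists \<Sigma>" and \<Sigma>: "finite \<Sigma>"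
  shows "card (breaks S) \<le> card S + Suc (card \<Sigma>) ^ card S"
proof -
  define B where "B = {i. (\<exists>V\<in>S. i < length V) \<and> (\<forall>j<i. \<exists>V\<in>S. i < length V \<and> V ! i \<noteq> V ! j)}"
  define h where "h i = restrict (\<lambda>V. if i < length V then Some (V ! i) else None) S" for i
  let ?T = "S \<rightarrow>\<^sub>E insert None (Some ` \<Sigma>)"
  have "h i \<noteq> h j" if "i \<in> B" "j < i" for i j
  proof -
    obtain V where V: "V \<in> S" "i < length V" "V ! i \<noteq> V ! j" using \<open>i \<in> B\<close> \<open>j < i\<close> by (auto simp: B_def)
    then have "h i V \<noteq> h j V" using \<open>j < i\<close> by (simp add: h_def)
    then show ?thesis by metis
  qed
  then have "inj_on h B" by (intro inj_onI) (metis linorder_neqE_nat)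
  moreover have "V ! i \<in> \<Sigma>" if "V \<in> S" "i < length V" for V i
    using S(2) that by (metis in_lists_conv_set nth_mem subsetD)
  then have "h ` B \<subseteq> ?T" by (auto simp: h_def)
  moreover have "finite ?T" using S(1) \<Sigma> by (intro finite_PiE) auto
  ultimately have "card B \<le> card ?T" by (rule card_inj_on_le)
  also have "\<dots> = Suc (card \<Sigma>) ^ card S"
    using S(1) \<Sigma> by (simp add: card_PiE card_insert_if card_image)
  finally have B: "card B \<le> Suc (card \<Sigma>) ^ card S" .
  have fB: "finite B"
    by (rule finite_subset[OF _ finite_breaks[OF S(1)]]) (auto simp: B_def breaks_def)
  have "card (breaks S) \<le> card (length ` S \<union> B)"
    by (rule card_mono) (use S(1) fB in \<open>auto simp: B_def breaks_def\<close>)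
  also have "\<dots> \<le> card (length ` S) + card B" by (rule card_Un_le)
  also have "\<dots> \<le> card S + Suc (card \<Sigma>) ^ card S"
    using B card_image_le[OF S(1), of length] by simp
  finally show ?thesis .
qed


section \<open>The Ramsey theorem for embedding types\<close>

lemma inj_subst_word:
  assumes V: "infinite_parameter_word V"
  shows "inj (subst_word V)"
proof (rule injI)
  fix X Y :: "'a list" assume eq: "subst_word V X = subst_word V Y"
  then have "first_pos V (length X) = first_pos V (length Y)" by (metis length_subst_word)
  then have len: "length X = length Y" by (metis nth_first_pos[OF V])
  show "X = Y"
  proof (rule nth_equalityI[OF len])
    fix i assume "i < length X"
    then have "subst_word V X ! first_pos V i = X ! i" "subst_word V Y ! first_pos V i = Y ! i"
      using len by (simp_all add: nth_subst_word first_pos_less_iff[OF V] nth_first_pos[OF V])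
    then show "X ! i = Y ! i" using eq by simp
  qed
qed

theorem embedding_type_Ramsey:
  fixes \<chi> :: "'a list set \<Rightarrow> 'c"
  assumes \<Sigma>: "finite \<Sigma>" and \<G>: "\<G> \<subseteq> lists \<Sigma>" "[] \<notin> \<G>" and k: "k \<ge> 1"
    and fin: "finite (\<chi> ` {S. S \<subseteq> \<G> \<and> card S = k})"
    and closed: "\<And>V X. infinite_parameter_word V \<Longrightarrow> X \<in> \<G> \<Longrightarrow> subst_word V X \<in> \<G>"
  obtains W where "infinite_parameter_word W"
    "\<And>S T. S \<subseteq> \<G> \<Longrightarrow> card S = k \<Longrightarrow> T \<subseteq> \<G> \<Longrightarrow> card T = k \<Longrightarrow> tau \<Sigma> S = tau \<Sigma> T \<Longrightarrow>
      \<chi> (subst_word W ` S) = \<chi> (subst_word W ` T)"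
proof -
  \<comment> \<open>The bound of \<open>card_breaks_le\<close> for \<open>k\<close>-element
    sets.\<close>
  define D where "D = k + Suc (card \<Sigma>) ^ k"
  define \<T> where "\<T> = Pow {U. set U \<subseteq> \<Sigma> \<and> length U \<le> D}"
  \<comment> \<open>One colour of \<open>E\<close> stores the colours of all \<open>E(T)\<close>;
    \<open>None\<close> marks those \<open>T\<close> for which \<open>E(T)\<close> is not a
    \<open>k\<close>-subset of \<open>\<G>\<close>. Restriction to the finite \<open>\<T>\<close>
    leaves finitely many colours.\<close>
  define c where "c E = restrict (\<lambda>T. if param_subst E ` T \<subseteq> \<G> \<and> card (param_subst E ` T) = k
      then Some (\<chi> (param_subst E ` T)) else None) \<T>" for E
  have "range c \<subseteq> \<T> \<rightarrow>\<^sub>E insert None (Some ` \<chi> ` {S. S \<subseteq> \<G> \<and> card S = k})"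
    by (auto simp: c_def)
  moreover have "finite (\<T> \<rightarrow>\<^sub>E insert None (Some ` \<chi> ` {S. S \<subseteq> \<G> \<and> card S = k}))"
    using fin finite_lists_length_le[OF \<Sigma>] by (intro finite_PiE) (auto simp: \<T>_def)
  ultimately have "finite (range c)" by (rule finite_subset)
  then have "finite (c ` {X. \<exists>d\<le>D. parameter_word d X})"
    by (rule finite_subset[rotated]) auto
  then obtain W where W: "infinite_parameter_word W"
    "\<And>d X Y. d \<le> D \<Longrightarrow> parameter_word d X \<Longrightarrow> parameter_word d Y \<Longrightarrow> c (subst_word W X) = c (subst_word W Y)"
    by (rule parameter_word_Ramsey_upto) blast
  \<comment> \<open>The number of parameters is expressed by the type alone, so that two sets of
    equal type yield words \<open>E\<close> with the same number of parameters.\<close>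
  have env: "\<exists>d E. d = Max (length ` tau \<Sigma> S) \<and> d \<le> D \<and> parameter_word d E \<and> tau \<Sigma> S \<in> \<T> \<and>
      c (subst_word W E) (tau \<Sigma> S) = Some (\<chi> (subst_word W ` S))"
    if S: "S \<subseteq> \<G>" "card S = k" for S
  proof -
    have fS: "finite S" using S k card.infinite by fastforce
    have sub: "S \<subseteq> lists \<Sigma>" using S \<G> by blast
    have "S \<noteq> {}" using S k by auto
    then obtain V0 where V0: "V0 \<in> S" "V0 \<noteq> []" using S(1) \<G>(2) by blast
    obtain E where E: "parameter_word (card (breaks S)) E" "param_subst E ` tau \<Sigma> S = S"
      "tau \<Sigma> S \<subseteq> lists \<Sigma>" "\<And>U. U \<in> tau \<Sigma> S \<Longrightarrow> length U \<le> card (breaks S)"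
      by (rule tau_envelope[OF fS sub V0]) blast
    have le: "card (breaks S) \<le> D" using card_breaks_le[OF fS sub \<Sigma>] S(2) by (simp add: D_def)
    have "tau \<Sigma> S \<in> \<T>" using E(3) le order_trans[OF E(4)] by (auto simp: \<T>_def)
    moreover have "param_subst (subst_word W E) ` tau \<Sigma> S = subst_word W ` param_subst E ` tau \<Sigma> S"
      unfolding image_image by (intro image_cong refl param_subst_subst_word[OF W(1) E(1)] E(4))
    then have "param_subst (subst_word W E) ` tau \<Sigma> S = subst_word W ` S" unfolding E(2) .
    moreover have "subst_word W ` S \<subseteq> \<G>" using S(1) closed[OF W(1)] by blast
    moreover have "card (subst_word W ` S) = k"
      using S(2) card_image[OF inj_on_subset[OF inj_subst_word[OF W(1)] subset_UNIV]] by metis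
    ultimately have "c (subst_word W E) (tau \<Sigma> S) = Some (\<chi> (subst_word W ` S))" by (simp add: c_def)
    then show ?thesis
      using card_breaks_eq_Max[OF fS sub V0] le E(1) \<open>tau \<Sigma> S \<in> \<T>\<close> by metis
  qed
  show ?thesis
  proof (rule that[OF W(1)])
    fix S T assume S: "S \<subseteq> \<G>" "card S = k" and T: "T \<subseteq> \<G>" "card T = k" and eq: "tau \<Sigma> S = tau \<Sigma> T"
    obtain d E where E: "d = Max (length ` tau \<Sigma> S)" "d \<le> D" "parameter_word d E"
      "c (subst_word W E) (tau \<Sigma> S) = Some (\<chi> (subst_word W ` S))" using env[OF S] by blast
    obtain d' E' where E': "d' = Max (length ` tau \<Sigma> T)" "parameter_word d' E'"
      "c (subst_word W E') (tau \<Sigma> T) = Some (\<chi> (subst_word W ` T))" using env[OF T] by blast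
    have "d' = d" using E(1) E'(1) eq by simp
    then have "c (subst_word W E) = c (subst_word W E')" using W(2)[OF E(2,3)] E'(2) by blast
    then have "Some (\<chi> (subst_word W ` S)) = Some (\<chi> (subst_word W ` T))" using E(4) E'(3) eq by metis
    then show "\<chi> (subst_word W ` S) = \<chi> (subst_word W ` T)" by simp
  qed
qed

section \<open>The structure \<open>G\<close>\<close>

text \<open>The way in which letters and triangles are read off from vertices of \<open>K\<close>;
  by \<open>pullback_embedding\<close> every letter arises like this.\<close>

definition pullback :: "'l language \<Rightarrow> ('v, 'l) rstruct \<Rightarrow> ('w \<Rightarrow> 'v) \<Rightarrow> 'w set \<Rightarrow> ('w, 'l) rstruct" where
  "pullback L K h X = \<lparr>verts = X, rel = (\<lambda>R. if R \<in> symbols L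
     then {xs. set xs \<subseteq> X \<and> length xs = arity L R \<and> map h xs \<in> rel K R} else {})\<rparr>"

lemma embedding_rel_iff:
  assumes "embedding L A B f" "R \<in> symbols L" "set xs \<subseteq> verts A" "length xs = arity L R"
  shows "map f xs \<in> rel B R \<longleftrightarrow> xs \<in> rel A R"
  using assms unfolding embedding_def homomorphism_def by blast

lemma embedding_pullback:
  assumes "inj_on h X" "h ` X \<subseteq> verts K"
  shows "embedding L (pullback L K h X) K h"
  using assms by (auto simp: embedding_def homomorphism_def pullback_def)

lemma is_structure_pullback: "is_structure L (pullback L K h X)"
  by (auto simp: is_structure_def pullback_def)

lemma pullback_embedding:
  assumes "is_structure L A" "embedding L A K f"
  shows "pullback L K f (verts A) = A"
proof -
  have "rel (pullback L K f (verts A)) = rel A"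
  proof
    fix R
    show "rel (pullback L K f (verts A)) R = rel A R"
      using assms embedding_rel_iff[OF assms(2), of R]
      unfolding pullback_def is_structure_def by (cases "R \<in> symbols L") auto
  qed
  then show ?thesis by (simp add: pullback_def)
qed

lemma embedding_pullback_comp:
  assumes "inj_on g Y" "g ` Y \<subseteq> X"
  shows "embedding L (pullback L K (h \<circ> g) Y) (pullback L K h X) g"
  using assms by (auto simp: embedding_def homomorphism_def pullback_def)

lemma is_triangle_pullback:
  fixes h :: "nat \<Rightarrow> 'v"
  shows "is_triangle L (pullback L K (h \<circ> pair_map 0 1) {0, 1}) (pullback L K (h \<circ> pair_map 1 2) {0, 1})
    (pullback L K (h \<circ> pair_map 0 2) {0, 1}) (pullback L K h {0, 1, 2})"
proof -
  have "verts (pullback L K h {0, 1, 2}) = {0, 1, 2}" by (simp add: pullback_def)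
  then show ?thesis unfolding is_triangle_def
    by (intro conjI is_structure_pullback embedding_pullback_comp)
      (auto simp: inj_on_def pair_map_def)
qed

lemma map_pair_map_exists:
  assumes "set xs \<subseteq> {a, b}"
  shows "\<exists>ys. set ys \<subseteq> {0, 1} \<and> xs = map (pair_map a b) ys"
proof (intro exI conjI)
  let ?ys = "map (\<lambda>x. if x = a then 0 else 1 :: nat) xs"
  show "set ?ys \<subseteq> {0, 1}" by auto
  have "map (pair_map a b \<circ> (\<lambda>x. if x = a then 0 else 1)) xs = xs"
    by (rule map_idI) (use assms in \<open>auto simp: pair_map_def\<close>)
  then show "xs = map (pair_map a b) ?ys" by simp
qed

text \<open>Relations have arity at most two, so every tuple of \<open>D\<close> lies in one of the
  three pairs, where the embeddings of \<open>A\<close>, \<open>B\<close> and \<open>C\<close>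
  determine it. This gives the uniqueness demanded by \<open>triangle\<close>.\<close>

lemma is_triangle_rel_subset:
  assumes ar: "\<forall>R\<in>symbols L. arity L R \<in> {1, 2}"
    and v: "verts A = {0, 1}" "verts B = {0, 1}" "verts C = {0, 1}"
    and D: "is_triangle L A B C D" and D': "is_triangle L A B C D'"
  shows "rel D R \<subseteq> rel D' R"
proof
  fix xs assume xs: "xs \<in> rel D R"
  have s: "is_structure L D" "verts D = {0, 1, 2}" using D by (auto simp: is_triangle_def)
  then have R: "R \<in> symbols L" using xs by (auto simp: is_structure_def)
  then have xs': "length xs = arity L R" "set xs \<subseteq> {0, 1, 2}" "length xs \<in> {1, 2}"
    using s xs ar unfolding is_structure_def by auto
  then obtain x y where "set xs = {x, y}" "x \<in> {0, 1, 2}" "y \<in> {0, 1, 2}"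
    by (auto simp: length_Suc_conv eval_nat_numeral)
  then have "set xs \<subseteq> {0, 1} \<or> set xs \<subseteq> {1, 2} \<or> set xs \<subseteq> {0, 2}" by auto
  moreover have "xs \<in> rel D' R"
    if ab: "set xs \<subseteq> {a, b}" and T: "embedding L T D (pair_map a b)" "embedding L T D' (pair_map a b)"
      "verts T = {0, 1}" for a b T
  proof -
    obtain ys where ys: "set ys \<subseteq> {0, 1}" "xs = map (pair_map a b) ys"
      using map_pair_map_exists[OF ab] by blast
    then show ?thesis
      using embedding_rel_iff[OF T(1) R, of ys] embedding_rel_iff[OF T(2) R, of ys] xs xs' T(3)
      by simp
  qed
  ultimately show "xs \<in> rel D' R" using D D' v unfolding is_triangle_def by metis
qed

lemma triangle_eq_Some:
  assumes "\<forall>R\<in>symbols L. arity L R \<in> {1, 2}"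
    and "verts A = {0, 1}" "verts B = {0, 1}" "verts C = {0, 1}"
    and D: "is_triangle L A B C D"
  shows "triangle L A B C = Some D"
proof -
  have uniq: "D' = D" if D': "is_triangle L A B C D'" for D'
  proof -
    have "rel D' = rel D"
      using is_triangle_rel_subset[OF assms(1-4) D D'] is_triangle_rel_subset[OF assms(1-4) D' D]
      by blast
    moreover have "verts D' = verts D" using D D' by (simp add: is_triangle_def)
    ultimately show ?thesis by simp
  qed
  then have "\<exists>!D. is_triangle L A B C D" using D by blast
  moreover from this have "(THE D. is_triangle L A B C D) = D" using D uniq by (intro the_equality) blast+
  ultimately show ?thesis by (simp add: triangle_def)
qed

text \<open>On a single vertex the only tuples are constant ones, so isomorphism amounts to having
  the same constant tuples. This turns the compatibility condition on vertices of \<open>G\<close>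
  into a comparison of relations.\<close>

lemma isomorphic_end_iff:
  assumes A: "is_structure L A" "1 \<in> verts A" and B: "is_structure L B" "1 \<in> verts B"
  shows "isomorphic L (induced A {1 :: nat}) (induced B {1 :: nat}) \<longleftrightarrow>
    (\<forall>R\<in>symbols L. replicate (arity L R) 1 \<in> rel A R \<longleftrightarrow> replicate (arity L R) 1 \<in> rel B R)"
    (is "_ \<longleftrightarrow> ?loops")
proof
  assume "isomorphic L (induced A {1}) (induced B {1})"
  then obtain f where f: "embedding L (induced A {1}) (induced B {1}) f" "f 1 = (1 :: nat)"
    by (auto simp: isomorphic_def induced_def)
  show ?loops
  proof
    fix R assume R: "R \<in> symbols L"
    have "set (replicate (arity L R) (1 :: nat)) \<subseteq> verts (induced A {1})" by (auto simp: induced_def)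
    from embedding_rel_iff[OF f(1) R this] f(2)
    show "replicate (arity L R) 1 \<in> rel A R \<longleftrightarrow> replicate (arity L R) 1 \<in> rel B R"
      by (auto simp: induced_def)
  qed
next
  assume loops: ?loops
  have rep: "xs = replicate (length xs) (1 :: nat)" if "set xs \<subseteq> {1}" for xs
    using that by (metis replicate_eqI subset_singletonD singletonD empty_iff)
  have iff: "xs \<in> rel A R \<longleftrightarrow> xs \<in> rel B R"
    if "R \<in> symbols L" "set xs \<subseteq> {1}" "length xs = arity L R" for R xs
    using loops that rep[of xs] by metis
  have "embedding L (induced A {1}) (induced B {1}) id"
    unfolding embedding_def homomorphism_def
    using iff A(1) by (auto simp: induced_def is_structure_def)
  then show "isomorphic L (induced A {1}) (induced B {1})"
    unfolding isomorphic_def by (intro exI[of _ id]) (simp add: induced_def)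
qed

lemma finite_alphabet:
  fixes L :: "'l language"
  assumes fin: "finite (symbols L)" and ar: "\<forall>R\<in>symbols L. arity L R \<in> {1, 2}"
  shows "finite (alphabet L K)"
proof -
  let ?h = "\<lambda>A :: (nat, 'l) rstruct. restrict (rel A) (symbols L)"
  let ?P = "symbols L \<rightarrow>\<^sub>E Pow {xs. set xs \<subseteq> {0, 1 :: nat} \<and> length xs \<le> 2}"
  have "inj_on ?h (alphabet L K)"
  proof (rule inj_onI)
    fix A B assume A: "A \<in> alphabet L K" and B: "B \<in> alphabet L K" and eq: "?h A = ?h B"
    have "rel A R = rel B R" for R
    proof (cases "R \<in> symbols L")
      case True then show ?thesis using fun_cong[OF eq, of R] by simp
    next
      case False then show ?thesis using A B by (simp add: alphabet_def is_structure_def)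
    qed
    then have "rel A = rel B" by blast
    moreover have "verts A = verts B" using A B by (simp add: alphabet_def)
    ultimately show "A = B" by simp
  qed
  moreover have "?h A \<in> ?P" if A: "A \<in> alphabet L K" for A
  proof -
    have "rel A R \<subseteq> {xs. set xs \<subseteq> {0, 1} \<and> length xs \<le> 2}" if R: "R \<in> symbols L" for R
    proof
      fix xs assume xs: "xs \<in> rel A R"
      have st: "is_structure L A" and v: "verts A = {0, 1}" using A by (simp_all add: alphabet_def)
      have "length xs = arity L R" "set xs \<subseteq> {0, 1}"
        using st R xs unfolding is_structure_def v by blast+
      moreover have "arity L R \<le> 2" using ar R by auto
      ultimately show "xs \<in> {xs. set xs \<subseteq> {0, 1} \<and> length xs \<le> 2}" by simp
    qed
    then show ?thesis by (simp add: PiE_iff)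
  qed
  then have "?h ` alphabet L K \<subseteq> ?P" by blast
  moreover have "finite ?P" using fin by (intro finite_PiE) (auto simp: finite_lists_length_le)
  ultimately show ?thesis by (rule inj_on_finite)
qed


section \<open>Substitution on the vertices of \<open>G\<close>\<close>

lemma embeddingI:
  assumes A: "is_structure L A" and "f ` verts A \<subseteq> verts B" "inj_on f (verts A)"
    and iff: "\<And>R xs. R \<in> symbols L \<Longrightarrow> set xs \<subseteq> verts A \<Longrightarrow> length xs = arity L R \<Longrightarrow>
      map f xs \<in> rel B R \<longleftrightarrow> xs \<in> rel A R"
  shows "embedding L A B f"
proof -
  have "map f xs \<in> rel B R" if "R \<in> symbols L" "xs \<in> rel A R" for R xs
    using A that iff[of R xs] unfolding is_structure_def by blast
  then show ?thesis using assms(2,3) iff unfolding embedding_def homomorphism_def by blast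
qed

lemma embedding_verts:
  assumes "embedding L A B f"
  shows "f ` verts A \<subseteq> verts B" "inj_on f (verts A)"
  using assms by (simp_all add: embedding_def homomorphism_def)

lemma is_structure_induced:
  assumes "is_structure L A"
  shows "is_structure L (induced A X)"
  using assms by (auto simp: is_structure_def induced_def)

lemma embedding_comp:
  assumes A: "is_structure L A" and g: "embedding L A B g" and f: "embedding L B C f"
  shows "embedding L A C (f \<circ> g)"
proof (rule embeddingI[OF A])
  note vg = embedding_verts[OF g] and vf = embedding_verts[OF f]
  show "(f \<circ> g) ` verts A \<subseteq> verts C" using vg(1) vf(1) by auto
  show "inj_on (f \<circ> g) (verts A)" using comp_inj_on[OF vg(2)] inj_on_subset[OF vf(2) vg(1)] .
  fix R xs assume R: "R \<in> symbols L" and xs: "set xs \<subseteq> verts A" "length xs = arity L R"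
  have "set (map g xs) \<subseteq> verts B" using xs(1) vg(1) by auto
  then show "map (f \<circ> g) xs \<in> rel C R \<longleftrightarrow> xs \<in> rel A R"
    using embedding_rel_iff[OF g R xs] embedding_rel_iff[OF f R, of "map g xs"] xs(2) by simp
qed

lemma embedding_into_induced:
  assumes A: "is_structure L A" and g: "embedding L A B g" and X: "g ` verts A \<subseteq> X"
  shows "embedding L A (induced B X) g"
proof (rule embeddingI[OF A])
  show "g ` verts A \<subseteq> verts (induced B X)" using X by (simp add: induced_def)
  show "inj_on g (verts A)" by (rule embedding_verts(2)[OF g])
  fix R xs assume R: "R \<in> symbols L" and xs: "set xs \<subseteq> verts A" "length xs = arity L R"
  have "set (map g xs) \<subseteq> X" using xs(1) X by auto
  then show "map g xs \<in> rel (induced B X) R \<longleftrightarrow> xs \<in> rel A R"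
    using embedding_rel_iff[OF g R xs] by (simp add: induced_def)
qed

lemma alphabetD:
  assumes "A \<in> alphabet L K"
  shows "is_structure L A" "verts A = {0, 1}" "embeds L A K"
  using assms by (simp_all add: alphabet_def)

lemma G_vertsD:
  assumes "X \<in> G_verts L K"
  shows "X \<noteq> []" "set X \<subseteq> alphabet L K"
  using assms by (auto simp: G_verts_def)

lemma G_verts_loops:
  assumes X: "X \<in> G_verts L K" and "i < length X" "j < length X" "R \<in> symbols L"
  shows "replicate (arity L R) 1 \<in> rel (X ! i) R \<longleftrightarrow> replicate (arity L R) 1 \<in> rel (X ! j) R"
proof -
  have "X ! i \<in> alphabet L K" "X ! j \<in> alphabet L K"
    using G_vertsD(2)[OF X] assms(2,3) nth_mem by blast+
  then have "isomorphic L (induced (X ! i) {1}) (induced (X ! j) {1}) \<longleftrightarrow>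
      (\<forall>R\<in>symbols L. replicate (arity L R) 1 \<in> rel (X ! i) R \<longleftrightarrow> replicate (arity L R) 1 \<in> rel (X ! j) R)"
    by (intro isomorphic_end_iff) (simp_all add: alphabetD(1,2))
  moreover have "isomorphic L (induced (X ! i) {1}) (induced (X ! j) {1})"
    using X assms(2,3) by (simp add: G_verts_def)
  ultimately show ?thesis using assms(4) by blast
qed

lemma G_vertsI:
  assumes "X \<noteq> []" "set X \<subseteq> alphabet L K"
    and loops: "\<And>i j R. i < length X \<Longrightarrow> j < length X \<Longrightarrow> R \<in> symbols L \<Longrightarrow>
      replicate (arity L R) 1 \<in> rel (X ! i) R \<longleftrightarrow> replicate (arity L R) 1 \<in> rel (X ! j) R"
  shows "X \<in> G_verts L K"
proof -
  have "isomorphic L (induced (X ! i) {1}) (induced (X ! j) {1})" if i: "i < length X" and j: "j < length X" for i j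
  proof -
    have "X ! i \<in> alphabet L K" "X ! j \<in> alphabet L K" using assms(2) i j nth_mem by blast+
    then have "isomorphic L (induced (X ! i) {1}) (induced (X ! j) {1}) \<longleftrightarrow>
        (\<forall>R\<in>symbols L. replicate (arity L R) 1 \<in> rel (X ! i) R \<longleftrightarrow> replicate (arity L R) 1 \<in> rel (X ! j) R)"
      by (intro isomorphic_end_iff) (simp_all add: alphabetD(1,2))
    then show ?thesis using loops[OF i j] by blast
  qed
  moreover have "length X \<ge> 1" using assms(1) by (cases X) auto
  ultimately show ?thesis using assms(2) unfolding G_verts_def by blast
qed

lemma nth_subst_word_0:
  assumes "infinite_parameter_word V" "X \<noteq> []"
  shows "subst_word V X ! 0 = X ! 0" "subst_word V X \<noteq> []"
proof -
  have "0 < first_pos V (length X)" using first_pos_less_iff[OF assms(1), of 0 "length X"] assms(2) by simp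
  moreover have "V 0 = 0" using nth_le[OF assms(1), of 0] by simp
  ultimately show "subst_word V X ! 0 = X ! 0" "subst_word V X \<noteq> []"
    by (simp_all add: nth_subst_word subst_word_def)
qed

lemma subst_word_G_verts:
  assumes V: "infinite_parameter_word V" and X: "X \<in> G_verts L K"
  shows "subst_word V X \<in> G_verts L K"
proof (rule G_vertsI)
  show "subst_word V X \<noteq> []" by (rule nth_subst_word_0(2)[OF V G_vertsD(1)[OF X]])
  show "set (subst_word V X) \<subseteq> alphabet L K" 
    by (rule subset_trans[OF set_subst_word_subset[OF V] G_vertsD(2)[OF X]])
  fix i j R assume ij: "i < length (subst_word V X)" "j < length (subst_word V X)" and R: "R \<in> symbols L"
  then have "V i < length X" "V j < length X" using less_if_less_first_pos[OF V] by simp_all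
  from G_verts_loops[OF X this R]
  show "replicate (arity L R) 1 \<in> rel (subst_word V X ! i) R \<longleftrightarrow> replicate (arity L R) 1 \<in> rel (subst_word V X ! j) R"
    using ij by (simp add: nth_subst_word)
qed

lemma nth_subst_word_length:
  assumes V: "infinite_parameter_word V" and "length X < length Y"
  shows "subst_word V Y ! length (subst_word V X) = Y ! length X"
  using assms(2) by (simp add: nth_subst_word first_pos_less_iff[OF V] nth_first_pos[OF V])

lemma G_related_subst_word:
  assumes V: "infinite_parameter_word V" and X: "X \<in> G_verts L K" and Y: "Y \<in> G_verts L K"
  shows "G_related L K (subst_word V X) (subst_word V Y) \<longleftrightarrow> G_related L K X Y"
proof (cases "length X < length Y")
  case True
  define Q where "Q A C \<longleftrightarrow> (\<exists>D. triangle L A (Y ! length X) C = Some D \<and> embeds L D K)" for A C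
  have "(\<forall>i<first_pos V (length X). Q (subst_word V X ! i) (subst_word V Y ! i)) \<longleftrightarrow> (\<forall>i<length X. Q (X ! i) (Y ! i))"
  proof
    assume l: "\<forall>i<first_pos V (length X). Q (subst_word V X ! i) (subst_word V Y ! i)"
    show "\<forall>i<length X. Q (X ! i) (Y ! i)"
    proof (intro allI impI)
      fix i assume i: "i < length X"
      then have "first_pos V i < first_pos V (length X)" "first_pos V i < first_pos V (length Y)" using True first_pos_less_iff[OF V] by simp_all
      then show "Q (X ! i) (Y ! i)" using l nth_first_pos[OF V, of i] by (metis nth_subst_word)
    qed
  next
    assume r: "\<forall>i<length X. Q (X ! i) (Y ! i)"
    show "\<forall>i<first_pos V (length X). Q (subst_word V X ! i) (subst_word V Y ! i)"
    proof (intro allI impI)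
      fix i assume i: "i < first_pos V (length X)"
      then have "i < first_pos V (length Y)" using True first_pos_less_iff[OF V] by (meson less_trans)
      then show "Q (subst_word V X ! i) (subst_word V Y ! i)" using r less_if_less_first_pos[OF V i] i by (simp add: nth_subst_word)
    qed
  qed
  then show ?thesis
    using subst_word_G_verts[OF V X] subst_word_G_verts[OF V Y] X Y True
    unfolding G_related_def nth_subst_word_length[OF V True] Q_def by (simp add: first_pos_less_iff[OF V])
next
  case False
  then show ?thesis by (simp add: G_related_def first_pos_less_iff[OF V])
qed

section \<open>Related partners for vertices of \<open>G\<close>\<close>

lemma pullback_cong:
  assumes "\<And>x. x \<in> X \<Longrightarrow> h x = h' x"
  shows "pullback L K h X = pullback L K h' X"
proof -
  have "map h xs = map h' xs" if "set xs \<subseteq> X" for xs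
    using that assms by (intro map_cong refl) blast
  then have *: "{xs. set xs \<subseteq> X \<and> length xs = n \<and> map h xs \<in> Y} =
      {xs. set xs \<subseteq> X \<and> length xs = n \<and> map h' xs \<in> Y}" for n Y
    by (intro Collect_cong) metis
  show ?thesis unfolding pullback_def * ..
qed

lemma embedding_alphabet_pullback:
  assumes A: "A \<in> alphabet L K" and e: "embedding L A K e"
  shows "pullback L K e {0, 1} = A"
  using pullback_embedding[OF alphabetD(1)[OF A] e] alphabetD(2)[OF A] by simp

lemma pullback_in_alphabet:
  assumes "inj_on h {0, 1}" "h ` {0, 1} \<subseteq> verts K"
  shows "pullback L K h {0, 1} \<in> alphabet L K"
  using embedding_pullback[OF assms, of L] is_structure_pullback[of L K h "{0, 1}"]
  unfolding alphabet_def embeds_def by (auto simp: pullback_def)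

lemma G_related_pullback:
  fixes h :: "nat \<Rightarrow> 'v"
  assumes ar: "\<forall>R\<in>symbols L. arity L R \<in> {1, 2}"
    and h: "inj_on h {0, 1, 2}" "h ` {0, 1, 2} \<subseteq> verts K"
  shows "triangle L (pullback L K (h \<circ> pair_map 0 1) {0, 1}) (pullback L K (h \<circ> pair_map 1 2) {0, 1})
    (pullback L K (h \<circ> pair_map 0 2) {0, 1}) = Some (pullback L K h {0, 1, 2})"
    "embeds L (pullback L K h {0, 1, 2}) K"
proof -
  show "triangle L (pullback L K (h \<circ> pair_map 0 1) {0, 1}) (pullback L K (h \<circ> pair_map 1 2) {0, 1})
    (pullback L K (h \<circ> pair_map 0 2) {0, 1}) = Some (pullback L K h {0, 1, 2})"
    by (rule triangle_eq_Some[OF ar _ _ _ is_triangle_pullback]) (simp_all add: pullback_def)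
  show "embeds L (pullback L K h {0, 1, 2}) K"
    using embedding_pullback[OF h] by (auto simp: embeds_def)
qed

text \<open>The letter is realised by two vertices of \<open>K\<close>, and infinity of
  \<open>K\<close> supplies a third vertex \<open>w\<close>. The two structures joining the old
  vertices to \<open>w\<close> are the letters of the partner.\<close>

lemma partner_of_letter:
  assumes ar: "\<forall>R\<in>symbols L. arity L R \<in> {1, 2}" and inf: "infinite (verts K)"
    and X: "[A] \<in> G_verts L K"
  shows "\<exists>Y. G_related L K [A] Y"
proof -
  have A: "A \<in> alphabet L K" using G_vertsD(2)[OF X] by simp
  obtain e where e: "embedding L A K e" using alphabetD(3)[OF A] by (auto simp: embeds_def)
  then have e01: "e 0 \<in> verts K" "e 1 \<in> verts K" "e 0 \<noteq> e 1"
    using alphabetD(2)[OF A] by (auto simp: embedding_def homomorphism_def inj_on_def)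
  have "infinite (verts K - {e 0, e 1})" using inf by simp
  then obtain w where w: "w \<in> verts K" "w \<noteq> e 0" "w \<noteq> e 1" by (metis Diff_iff finite.emptyI insertI1 insertI2 insertCI ex_in_conv)
  define h where "h i = (if i = 2 then w else e i)" for i
  have h: "inj_on h {0, 1, 2}" "h ` {0, 1, 2} \<subseteq> verts K"
    using e01 w by (auto simp: h_def inj_on_def)
  let ?B = "pullback L K (h \<circ> pair_map 1 2) {0, 1}" and ?C = "pullback L K (h \<circ> pair_map 0 2) {0, 1}"
  have "pullback L K (h \<circ> pair_map 0 1) {0, 1} = pullback L K e {0, 1}"
    by (rule pullback_cong) (auto simp: h_def pair_map_def)
  then have A_eq: "pullback L K (h \<circ> pair_map 0 1) {0, 1} = A"
    using embedding_alphabet_pullback[OF A e] by simp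
  \<comment> \<open>The order matters: index \<open>0\<close> is compared with the letter
    \<open>A\<close>, and index \<open>1\<close>, the length of \<open>[A]\<close>, must hold the
    structure on the new pair. Both letters have \<open>w\<close> as second vertex, hence the same
    constant tuples at \<open>1\<close>.\<close>
  have "[?C, ?B] \<in> G_verts L K"
  proof (rule G_vertsI)
    have "?B \<in> alphabet L K" "?C \<in> alphabet L K"
      by (rule pullback_in_alphabet; use h in \<open>auto simp: inj_on_def pair_map_def\<close>)+
    then show "set [?C, ?B] \<subseteq> alphabet L K" by simp
    fix i j R assume ij: "i < length [?C, ?B]" "j < length [?C, ?B]" and R: "R \<in> symbols L"
    have "replicate (arity L R) 1 \<in> rel ([?C, ?B] ! i) R \<longleftrightarrow> replicate (arity L R) w \<in> rel K R"
      if "i < length [?C, ?B]" for i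
      using that R by (auto simp: pullback_def pair_map_def h_def less_Suc_eq)
    then show "replicate (arity L R) 1 \<in> rel ([?C, ?B] ! i) R \<longleftrightarrow> replicate (arity L R) 1 \<in> rel ([?C, ?B] ! j) R"
      using ij by blast
  qed simp
  then have "G_related L K [A] [?C, ?B]"
    using X G_related_pullback[OF ar h] unfolding A_eq by (auto simp: G_related_def)
  then show ?thesis ..
qed

text \<open>The structure obtained from the first two letters of a word by identifying their second
  vertices is a path, so it has no induced cycles and the hypothesis on \<open>K\<close> applies to it.\<close>

lemma partner_of_word:
  fixes L :: "'l language"
  assumes ar: "\<forall>R\<in>symbols L. arity L R \<in> {1, 2}"
    and K: "is_structure L K" and irr: "irreducible_struct L K"
    and cyc: "cycle_completion_property L K"
    and X: "X \<in> G_verts L K" "length X \<ge> 2"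
  shows "\<exists>Y. G_related L K Y X"
proof -
  define A where "A = X ! 0"
  define B where "B = X ! 1"
  have len: "0 < length X" "1 < length X" using X(2) by linarith+
  then have "A \<in> set X" "B \<in> set X" unfolding A_def B_def by (simp_all only: nth_mem)
  then have A: "A \<in> alphabet L K" and B: "B \<in> alphabet L K" using G_vertsD(2)[OF X(1)] by blast+
  have AB: "replicate (arity L R) 1 \<in> rel A R \<longleftrightarrow> replicate (arity L R) 1 \<in> rel B R"
    if "R \<in> symbols L" for R
    unfolding A_def B_def by (rule G_verts_loops[OF X(1) len that])
  have tupA: "length xs = arity L R \<and> set xs \<subseteq> {0, 1} \<and> R \<in> symbols L" if "xs \<in> rel A R" for xs R
    using that alphabetD(1,2)[OF A] unfolding is_structure_def by blast
  have tupB: "length xs = arity L R \<and> set xs \<subseteq> {0, 1} \<and> R \<in> symbols L" if "xs \<in> rel B R" for xs R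
    using that alphabetD(1,2)[OF B] unfolding is_structure_def by blast
  \<comment> \<open>Vertex \<open>2\<close> is the common second vertex of \<open>A\<close> and
    \<open>B\<close>; the vertices \<open>0\<close> and \<open>1\<close> are left unrelated.\<close>
  define P :: "(nat, 'l) rstruct" where
    "P = \<lparr>verts = {0, 1, 2}, rel = (\<lambda>R. map (pair_map 0 2) ` rel A R \<union> map (pair_map 1 2) ` rel B R)\<rparr>"
  have relP: "\<exists>T a ys. (T = A \<and> a = 0 \<or> T = B \<and> a = 1) \<and> ys \<in> rel T R \<and> xs = map (pair_map a 2) ys"
    if "xs \<in> rel P R" for xs R
  proof -
    have "xs \<in> map (pair_map 0 2) ` rel A R \<union> map (pair_map 1 2) ` rel B R" using that by (simp add: P_def)
    then show ?thesis by blast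
  qed
  have P: "is_structure L P"
    unfolding is_structure_def
  proof (intro conjI ballI allI impI)
    fix R xs assume "xs \<in> rel P R"
    from relP[OF this] obtain T a ys where T: "T = A \<and> a = 0 \<or> T = B \<and> a = 1" "ys \<in> rel T R"
      and xs: "xs = map (pair_map a 2) ys" by blast
    have "length ys = arity L R" using T tupA tupB by blast
    then show "length xs = arity L R" using xs by simp
    show "set xs \<subseteq> verts P" using xs T(1) by (auto simp: P_def pair_map_def)
  next
    fix R assume "R \<notin> symbols L"
    then have "rel A R = {}" "rel B R = {}" using tupA tupB by blast+
    then show "rel P R = {}" by (simp add: P_def)
  qed
  have emb: "embedding L T P (pair_map a 2)"
    if T: "T = A \<and> a = 0 \<or> T = B \<and> a = 1" for T a
  proof -
    have v: "verts T = {0, 1}" using T alphabetD(2)[OF A] alphabetD(2)[OF B] by metis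
    have "ys \<in> rel T R"
      if R: "R \<in> symbols L" and ys: "set ys \<subseteq> {0, 1}" "length ys = arity L R" "map (pair_map a 2) ys \<in> rel P R"
      for R ys
    proof -
      obtain b T' zs where b: "T' = A \<and> b = 0 \<or> T' = B \<and> b = 1" "zs \<in> rel T' R"
        "map (pair_map a 2) ys = map (pair_map b 2) zs"
        using relP[OF ys(3)] by blast
      have zs: "set zs \<subseteq> {0, 1}" "length zs = arity L R" using b(1,2) tupA tupB by blast+
      have a01: "a \<in> {0, 1}" "b \<in> {0, 1}" using T b(1) by auto
      have pt: "pair_map a 2 (ys ! i) = pair_map b 2 (zs ! i)" if "i < arity L R" for i
        using that ys(2) zs(2) arg_cong[OF b(3), of "\<lambda>l. l ! i"] by simp
      have y01: "ys ! i \<in> {0, 1}" "zs ! i \<in> {0, 1}" if "i < arity L R" for i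
        using that ys(1,2) zs nth_mem by (metis subsetD)+
      have "ys ! i = zs ! i" if "i < arity L R" for i
        using pt[OF that] y01[OF that] a01 by (auto simp: pair_map_def split: if_splits)
      then have eq: "ys = zs" using ys(2) zs(2) by (simp add: list_eq_iff_nth_eq)
      show ?thesis
      proof (cases "a = b")
        case True
        then have "T = T'" using T b(1) by (metis zero_neq_one)
        then show ?thesis using b(2) eq by simp
      next
        case False
        \<comment> \<open>A tuple of \<open>P\<close> that comes from the other letter lies entirely
          at the shared vertex, and there the two letters agree by \<open>AB\<close>.\<close>
        have "ys ! i = 1" if "i < arity L R" for i
          using pt[OF that] y01[OF that] False a01 by (auto simp: pair_map_def split: if_splits)
        then have "ys = replicate (arity L R) 1" using ys(2) by (intro nth_equalityI) auto
        then show ?thesis using T b(1,2) eq AB[OF R] by metis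
      qed
    qed
    moreover have "map (pair_map a 2) ys \<in> rel P R" if "ys \<in> rel T R" for ys R
    proof -
      have "map (pair_map a 2) ys \<in> map (pair_map 0 2) ` rel A R \<union> map (pair_map 1 2) ` rel B R"
        using T that by blast
      then show ?thesis by (simp add: P_def)
    qed
    moreover have "inj_on (pair_map a 2) {0, 1}" "pair_map a 2 ` {0, 1} \<subseteq> verts P"
    proof -
      have "a = 0 \<or> a = 1" using T by blast
      then show "inj_on (pair_map a 2) {0, 1}" "pair_map a 2 ` {0, 1} \<subseteq> verts P"
        by (auto simp: inj_on_def pair_map_def P_def)
    qed
    ultimately show ?thesis unfolding embedding_def homomorphism_def v by blast
  qed
  \<comment> \<open>Letters embed into the irreducible \<open>K\<close>, so each of them relates its
    two vertices.\<close>
  have edge: "adjacent L P a 2" if T: "T \<in> alphabet L K" "embedding L T P (pair_map a 2)" "a \<noteq> 2" for T a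
  proof -
    obtain e where e: "embedding L T K e" using alphabetD(3)[OF T(1)] by (auto simp: embeds_def)
    have v: "verts T = {0, 1}" by (rule alphabetD(2)[OF T(1)])
    have "e 0 \<in> verts K" "e 1 \<in> verts K" using embedding_verts(1)[OF e] unfolding v by simp_all
    moreover have "e 0 \<noteq> e 1" using inj_onD[OF embedding_verts(2)[OF e], of 0 1] unfolding v by auto
    ultimately have "adjacent L K (e 0) (e 1)" using irr unfolding irreducible_struct_def by blast
    then obtain R xs where R: "R \<in> symbols L" "xs = [0, 1] \<or> xs = [1, 0]" "map e xs \<in> rel K R"
      unfolding adjacent_def by fastforce
    then have len: "length xs = arity L R" using K by (metis is_structure_def length_map)
    have "set xs \<subseteq> verts T" using R(2) unfolding v by auto
    then have "xs \<in> rel T R" using embedding_rel_iff[OF e R(1) _ len] R(3) by blast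
    then have "map (pair_map a 2) xs \<in> rel P R"
      using T(2) R(1) unfolding embedding_def homomorphism_def by blast
    then show ?thesis using R(1,2) T(3) by (auto simp: adjacent_def pair_map_def)
  qed
  have edges: "adjacent L P 0 2" "adjacent L P 1 2"
    using edge[OF A emb] edge[OF B emb] by simp_all
  have no_edge: "\<not> adjacent L P 0 1" "\<not> adjacent L P 1 0"
  proof -
    have "1 \<notin> set xs \<or> 0 \<notin> set xs" if "xs \<in> rel P R" for xs R
      using relP[OF that] by (auto simp: pair_map_def split: if_splits)
    then show "\<not> adjacent L P 0 1" "\<not> adjacent L P 1 0" by (fastforce simp: adjacent_def)+
  qed
  \<comment> \<open>A cycle would use all three vertices, and any two positions of a cycle of length
    three are consecutive, but \<open>0\<close> and \<open>1\<close> are not adjacent.\<close>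
  have "\<not> cycle L P c" for c
  proof
    assume c: "cycle L P c"
    then have dist: "distinct c" and sub: "set c \<subseteq> {0, 1, 2}" and len: "length c \<ge> 3"
      by (auto simp: cycle_def P_def)
    have "card (set c) = length c" using dist by (rule distinct_card)
    moreover have "card (set c) \<le> card {0, 1, 2 :: nat}" using sub by (intro card_mono) auto
    ultimately have len3: "length c = 3" using len by simp
    then have "set c = {0, 1, 2}" using \<open>card (set c) = length c\<close> sub by (intro card_subset_eq) auto
    then obtain i j where i: "i < 3" "c ! i = 0" and j: "j < 3" "c ! j = 1"
      using len3 by (metis in_set_conv_nth insertI1 insert_commute)
    then have "i \<noteq> j" by auto
    moreover have "i = 0 \<or> i = 1 \<or> i = 2" "j = 0 \<or> j = 1 \<or> j = 2" using i(1) j(1) by linarith+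
    ultimately have "j = Suc i mod 3 \<or> i = Suc j mod 3" by auto
    moreover have "adjacent L P (c ! m) (c ! (Suc m mod 3))" if "m < 3" for m
      using c that len3 unfolding cycle_def by simp
    ultimately have "adjacent L P 0 1 \<or> adjacent L P 1 0" using i j by metis
    then show False using no_edge by blast
  qed
  moreover have "embeds L (induced P Y) K"
    if Y: "Y \<subseteq> verts P" "irreducible_struct L (induced P Y)" for Y
  proof -
    have "\<not> (0 \<in> Y \<and> 1 \<in> Y)"
      using Y(2) no_edge unfolding irreducible_struct_def adjacent_def induced_def by auto
    then obtain T a where T: "T = A \<and> a = 0 \<or> T = B \<and> a = 1" and Ya: "Y \<subseteq> {a, 2 :: nat}"
      using Y(1) by (auto simp: P_def)
    have TA: "T \<in> alphabet L K" and a2: "a \<noteq> 2" using T A B by auto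
    obtain e where e: "embedding L T K e" using alphabetD(3)[OF TA] by (auto simp: embeds_def)
    note v = alphabetD(2)[OF TA]
    define g where "g x = (if x = a then e 0 else e 1)" for x
    have "embedding L (induced P Y) K g"
    proof (rule embeddingI[OF is_structure_induced[OF P]])
      show "g ` verts (induced P Y) \<subseteq> verts K" using embedding_verts(1)[OF e] v by (auto simp: g_def)
      show "inj_on g (verts (induced P Y))"
        using embedding_verts(2)[OF e] v Ya by (auto simp: g_def inj_on_def induced_def)
      fix R xs assume R: "R \<in> symbols L" and xs: "set xs \<subseteq> verts (induced P Y)" "length xs = arity L R"
      have "set xs \<subseteq> {a, 2}" using xs(1) Ya by (auto simp: induced_def)
      from map_pair_map_exists[OF this] obtain ys where
        ys: "set ys \<subseteq> {0, 1}" "xs = map (pair_map a 2) ys" by blast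
      have "g (pair_map a 2 y) = e y" if "y \<in> set ys" for y
        using that ys(1) a2 by (auto simp: g_def pair_map_def)
      then have "map g xs = map e ys" unfolding ys(2) by simp
      moreover have "set ys \<subseteq> verts T" "length ys = arity L R" using ys xs(2) v by auto
      then have "map e ys \<in> rel K R \<longleftrightarrow> xs \<in> rel P R"
        using embedding_rel_iff[OF e R, of ys] embedding_rel_iff[OF emb[OF T] R, of ys] ys(2) by blast
      ultimately show "map g xs \<in> rel K R \<longleftrightarrow> xs \<in> rel (induced P Y) R"
        using xs(1) by (simp add: induced_def)
    qed
    then show ?thesis by (auto simp: embeds_def)
  qed
  ultimately have "has_completion L P K"
    using cyc P unfolding cycle_completion_property_def induced_cycle_def by blast
  then obtain f where f: "homomorphism_embedding L P K f" "inj_on f {0, 1, 2}"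
    by (auto simp: has_completion_def P_def)
  have fv: "f ` {0, 1, 2} \<subseteq> verts K"
    using f(1) by (auto simp: homomorphism_embedding_def homomorphism_def P_def)
  \<comment> \<open>The completion is an embedding on each edge of the path, so the letters
    \<open>A\<close> and \<open>B\<close> are found unchanged in \<open>K\<close>.\<close>
  have pull: "pullback L K (f \<circ> pair_map a 2) {0, 1} = T" if T: "T = A \<and> a = 0 \<or> T = B \<and> a = 1" for T a
  proof -
    have TA: "T \<in> alphabet L K" and ad: "adjacent L P a 2" using T A B edges by auto
    then have "irreducible_struct L (induced P {a, 2})"
      unfolding irreducible_struct_def adjacent_def by (auto simp: induced_def)
    moreover have "{a, 2} \<subseteq> verts P" using T by (auto simp: P_def)
    ultimately have fe: "embedding L (induced P {a, 2}) K f"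
      using f(1) by (simp add: homomorphism_embedding_def)
    have "pair_map a 2 ` verts T \<subseteq> {a, 2}" by (auto simp: pair_map_def)
    then have "embedding L T K (f \<circ> pair_map a 2)"
      by (rule embedding_comp[OF alphabetD(1)[OF TA]
            embedding_into_induced[OF alphabetD(1)[OF TA] emb[OF T]] fe])
    then show ?thesis by (rule embedding_alphabet_pullback[OF TA])
  qed
  \<comment> \<open>The completion decides how the first vertices of \<open>A\<close> and
    \<open>B\<close> are related. The resulting one-letter word is the partner: its length is
    \<open>1\<close>, so only the triangle at index \<open>0\<close>, with \<open>B\<close> at index
    \<open>1\<close>, has to be checked.\<close>
  let ?C = "pullback L K (f \<circ> pair_map 0 1) {0, 1}"
  have "?C \<in> alphabet L K"
    by (rule pullback_in_alphabet) (use f(2) fv in \<open>auto simp: inj_on_def pair_map_def\<close>)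
  then have "[?C] \<in> G_verts L K" by (intro G_vertsI) auto
  moreover have "triangle L ?C B A = Some (pullback L K f {0, 1, 2})"
    using G_related_pullback(1)[OF ar f(2) fv] pull[of A 0] pull[of B 1] by simp
  ultimately have "G_related L K [?C] X"
    using X G_related_pullback(2)[OF ar f(2) fv] by (auto simp: G_related_def A_def B_def)
  then show ?thesis ..
qed

text \<open>The relations of \<open>G\<close> come from related pairs only, so a vertex carries the loops prescribed by its
  letters only because it lies in some related pair.\<close>

lemma partner_exists:
  assumes "\<forall>R\<in>symbols L. arity L R \<in> {1, 2}" "is_structure L K" "infinite (verts K)"
    "irreducible_struct L K" "cycle_completion_property L K" and X: "X \<in> G_verts L K"
  shows "\<exists>Y. G_related L K X Y \<or> G_related L K Y X"
proof (cases "length X \<ge> 2")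
  case True
  then show ?thesis using partner_of_word[OF assms(1,2,4,5) X] by blast
next
  case False
  then obtain A where "X = [A]" using G_vertsD(1)[OF X] by (cases X; cases "tl X") auto
  then show ?thesis using partner_of_letter[OF assms(1,3)] X by blast
qed

section \<open>The relations of \<open>G\<close>\<close>

text \<open>In the triangle at index \<open>0\<close>, the second vertex of \<open>U ! 0\<close> is
  the first vertex of \<open>V ! length U\<close>. Hence the constant tuples that a related pair
  prescribes at either vertex agree with those at the second vertex of its own letters.\<close>

lemma G_relatedD:
  assumes UV: "G_related L K U V"
  shows "V ! length U \<in> alphabet L K" "U \<in> G_verts L K" "V \<in> G_verts L K" "U \<noteq> V"
    "R \<in> symbols L \<Longrightarrow> replicate (arity L R) 1 \<in> rel (V ! length U) R \<longleftrightarrow> replicate (arity L R) 1 \<in> rel (V ! 0) R"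
    "R \<in> symbols L \<Longrightarrow> replicate (arity L R) 0 \<in> rel (V ! length U) R \<longleftrightarrow> replicate (arity L R) 1 \<in> rel (U ! 0) R"
proof -
  show U: "U \<in> G_verts L K" and V: "V \<in> G_verts L K" and "U \<noteq> V" using UV by (auto simp: G_related_def)
  have less: "length U < length V" using UV by (simp add: G_related_def)
  then show B: "V ! length U \<in> alphabet L K" using G_vertsD(2)[OF V] nth_mem by blast
  have 0: "0 < length U" using G_vertsD(1)[OF U] by simp
  then have A: "U ! 0 \<in> alphabet L K" using G_vertsD(2)[OF U] nth_mem by blast
  obtain D where "triangle L (U ! 0) (V ! length U) (V ! 0) = Some D"
    using UV 0 unfolding G_related_def by blast
  then have "\<exists>!D. is_triangle L (U ! 0) (V ! length U) (V ! 0) D"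
    unfolding triangle_def by (metis option.distinct(1))
  then obtain D where "is_triangle L (U ! 0) (V ! length U) (V ! 0) D" by blast
  then have D: "embedding L (U ! 0) D (pair_map 0 1)" "embedding L (V ! length U) D (pair_map 1 2)"
    by (simp_all add: is_triangle_def)
  assume R: "R \<in> symbols L"
  show "replicate (arity L R) 1 \<in> rel (V ! length U) R \<longleftrightarrow> replicate (arity L R) 1 \<in> rel (V ! 0) R"
    by (rule G_verts_loops[OF V less _ R]) (use less in linarith)
  have "set (replicate (arity L R) 1) \<subseteq> verts (U ! 0)" "set (replicate (arity L R) 0) \<subseteq> verts (V ! length U)"
    unfolding alphabetD(2)[OF A] alphabetD(2)[OF B] by auto
  from embedding_rel_iff[OF D(1) R this(1)] embedding_rel_iff[OF D(2) R this(2)]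
  show "replicate (arity L R) 0 \<in> rel (V ! length U) R \<longleftrightarrow> replicate (arity L R) 1 \<in> rel (U ! 0) R"
    by (simp add: pair_map_def)
qed

lemma rel_G_iff:
  "xs \<in> rel (G L K) R \<longleftrightarrow>
    (\<exists>U V ys. xs = map (pair_map U V) ys \<and> G_related L K U V \<and> ys \<in> rel (V ! length U) R)"
  by (auto simp: G_def)

lemma is_structure_G: "is_structure L (G L K)"
proof -
  have "length xs = arity L R \<and> set xs \<subseteq> G_verts L K \<and> R \<in> symbols L" if xs: "xs \<in> rel (G L K) R" for xs R
  proof -
    obtain U V ys where UV: "xs = map (pair_map U V) ys" "G_related L K U V" "ys \<in> rel (V ! length U) R"
      using xs unfolding rel_G_iff by blast
    have "length ys = arity L R" "R \<in> symbols L"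
      using alphabetD(1)[OF G_relatedD(1)[OF UV(2)]] UV(3) unfolding is_structure_def by blast+
    then show ?thesis using UV(1) G_relatedD(2,3)[OF UV(2)] by (auto simp: pair_map_def)
  qed
  moreover have "verts (G L K) = G_verts L K" by (simp add: G_def)
  ultimately show ?thesis unfolding is_structure_def by blast
qed

text \<open>The constant tuples prescribed at \<open>X\<close> by different related pairs agree, by
  \<open>G_relatedD\<close>; that some pair prescribes them is the content of
  \<open>partner_exists\<close>.\<close>

lemma loop_in_G_iff:
  assumes ar: "\<forall>R\<in>symbols L. arity L R \<in> {1, 2}" and K: "is_structure L K" "infinite (verts K)"
    "irreducible_struct L K" "cycle_completion_property L K"
    and X: "X \<in> G_verts L K" and R: "R \<in> symbols L"
  shows "replicate (arity L R) X \<in> rel (G L K) R \<longleftrightarrow> replicate (arity L R) 1 \<in> rel (X ! 0) R"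
proof
  have n: "arity L R \<noteq> 0" using ar R by auto
  assume "replicate (arity L R) X \<in> rel (G L K) R"
  then obtain U V ys where UV: "replicate (arity L R) X = map (pair_map U V) ys" "G_related L K U V"
    "ys \<in> rel (V ! length U) R"
    unfolding rel_G_iff by blast
  have ys: "set ys \<subseteq> {0, 1}" "length ys = arity L R"
    using alphabetD(1,2)[OF G_relatedD(1)[OF UV(2)]] UV(3) R unfolding is_structure_def by auto
  have const: "pair_map U V y = X" if "y \<in> set ys" for y
  proof -
    have "pair_map U V y \<in> set (replicate (arity L R) X)" unfolding UV(1) using that by simp
    then show ?thesis by (auto split: if_splits)
  qed
  obtain y where y: "y \<in> set ys" using ys(2) n by (cases ys) auto
  \<comment> \<open>The two vertices of a related pair differ, so a tuple with constant image is
    constant.\<close>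
  have "z = y" if "z \<in> set ys" for z
    using const[OF that] const[OF y] ys(1) that y G_relatedD(4)[OF UV(2)]
    by (auto simp: pair_map_def split: if_splits)
  then have rep: "ys = replicate (arity L R) y" using ys(2) by (metis replicate_eqI)
  have "y = 0 \<or> y = 1" using y ys(1) by auto
  then show "replicate (arity L R) 1 \<in> rel (X ! 0) R"
    using UV(3) const[OF y] G_relatedD(5,6)[OF UV(2) R] unfolding rep by (auto simp: pair_map_def)
next
  assume loop: "replicate (arity L R) 1 \<in> rel (X ! 0) R"
  obtain Y where "G_related L K X Y \<or> G_related L K Y X" using partner_exists[OF ar K X] by blast
  then show "replicate (arity L R) X \<in> rel (G L K) R"
  proof
    assume XY: "G_related L K X Y"
    then have "replicate (arity L R) 0 \<in> rel (Y ! length X) R" using G_relatedD(6)[OF XY R] loop by simp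
    moreover have "replicate (arity L R) X = map (pair_map X Y) (replicate (arity L R) 0)"
      by (simp add: pair_map_def)
    ultimately show ?thesis unfolding rel_G_iff using XY by blast
  next
    assume YX: "G_related L K Y X"
    then have "replicate (arity L R) 1 \<in> rel (X ! length Y) R" using G_relatedD(5)[OF YX R] loop by simp
    moreover have "replicate (arity L R) X = map (pair_map Y X) (replicate (arity L R) 1)"
      by (simp add: pair_map_def)
    ultimately show ?thesis unfolding rel_G_iff using YX by blast
  qed
qed

text \<open>Only the pair formed by \<open>X\<close> and \<open>Y\<close> themselves can contribute
  this tuple. The shorter word plays the role of \<open>0\<close>, which explains the reversed tuple
  in the second case.\<close>

lemma pair_in_G_iff:
  assumes "X \<noteq> Y"
  shows "[X, Y] \<in> rel (G L K) R \<longleftrightarrow>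
    G_related L K X Y \<and> [0, 1] \<in> rel (Y ! length X) R \<or> G_related L K Y X \<and> [1, 0] \<in> rel (X ! length Y) R"
proof
  assume "[X, Y] \<in> rel (G L K) R"
  then obtain U V ys where UV: "[X, Y] = map (pair_map U V) ys" "G_related L K U V" "ys \<in> rel (V ! length U) R"
    unfolding rel_G_iff by (elim exE conjE) (rule that)
  obtain a b where ys: "ys = [a, b]" "pair_map U V a = X" "pair_map U V b = Y" using UV(1) by auto
  have st: "is_structure L (V ! length U)" "verts (V ! length U) = {0, 1}"
    using alphabetD(1,2)[OF G_relatedD(1)[OF UV(2)]] by blast+
  then have "set ys \<subseteq> {0, 1}" using UV(3) unfolding is_structure_def by blast
  then show "G_related L K X Y \<and> [0, 1] \<in> rel (Y ! length X) R \<or> G_related L K Y X \<and> [1, 0] \<in> rel (X ! length Y) R"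
    using ys UV(2,3) assms by (auto simp: pair_map_def split: if_splits)
next
  have "[X, Y] = map (pair_map X Y) [0, 1]" "[X, Y] = map (pair_map Y X) [1, 0]"
    by (simp_all add: pair_map_def)
  then show "[X, Y] \<in> rel (G L K) R"
    if "G_related L K X Y \<and> [0, 1] \<in> rel (Y ! length X) R \<or> G_related L K Y X \<and> [1, 0] \<in> rel (X ! length Y) R"
    using that unfolding rel_G_iff by metis
qed

text \<open>Tuples have one or two entries, so they are either constant or list two distinct
  vertices. Constant tuples depend on the letter at index \<open>0\<close> alone, which substitution
  keeps; the others depend on relatedness and on the letter \<open>Y ! length X\<close>, which is
  kept at the moved index.\<close>

lemma embedding_subst_word:
  assumes ar: "\<forall>R\<in>symbols L. arity L R \<in> {1, 2}" and K: "is_structure L K" "infinite (verts K)"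
    "irreducible_struct L K" "cycle_completion_property L K"
    and W: "infinite_parameter_word W"
  shows "embedding L (G L K) (G L K) (subst_word W)"
proof (rule embeddingI[OF is_structure_G])
  have vG: "verts (G L K) = G_verts L K" by (simp add: G_def)
  show "subst_word W ` verts (G L K) \<subseteq> verts (G L K)" using subst_word_G_verts[OF W] unfolding vG by blast
  show "inj_on (subst_word W) (verts (G L K))" using inj_subst_word[OF W] by (rule inj_on_subset) simp
  fix R xs assume R: "R \<in> symbols L" and xs: "set xs \<subseteq> verts (G L K)" "length xs = arity L R"
  have loop: "replicate (arity L R) (subst_word W X) \<in> rel (G L K) R \<longleftrightarrow> replicate (arity L R) X \<in> rel (G L K) R"
    if X: "X \<in> G_verts L K" for X
    unfolding loop_in_G_iff[OF ar K X R] loop_in_G_iff[OF ar K subst_word_G_verts[OF W X] R]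
      nth_subst_word_0(1)[OF W G_vertsD(1)[OF X]] ..
  have "arity L R = 1 \<or> arity L R = 2" using ar R by auto
  then consider X where "xs = replicate (arity L R) X" "X \<in> G_verts L K" |
    X Y where "xs = [X, Y]" "X \<noteq> Y" "X \<in> G_verts L K" "Y \<in> G_verts L K"
  proof
    assume "arity L R = 1"
    then obtain X where "xs = [X]" using xs(2) by (auto simp: length_Suc_conv)
    then show thesis using that(1)[of X] xs \<open>arity L R = 1\<close> by (simp add: vG)
  next
    assume a2: "arity L R = 2"
    then obtain X Y where "xs = [X, Y]" using xs(2) by (auto simp: length_Suc_conv eval_nat_numeral)
    then show thesis using that(1)[of X] that(2)[of X Y] xs a2
      by (cases "X = Y") (auto simp: vG eval_nat_numeral)
  qed
  then show "map (subst_word W) xs \<in> rel (G L K) R \<longleftrightarrow> xs \<in> rel (G L K) R"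
  proof cases
    case 1
    then show ?thesis using loop[OF 1(2)] by (simp add: map_replicate)
  next
    case 2
    have ne: "subst_word W X \<noteq> subst_word W Y" using inj_subst_word[OF W] 2(2) by (metis injD)
    \<comment> \<open>Stated for an arbitrary property of the letter so that it covers both
      orientations.\<close>
    have XY: "G_related L K (subst_word W X) (subst_word W Y) \<and> P (subst_word W Y ! length (subst_word W X)) \<longleftrightarrow>
        G_related L K X Y \<and> P (Y ! length X)"
      if X: "X \<in> G_verts L K" and Y: "Y \<in> G_verts L K" for X Y P
    proof (cases "G_related L K X Y")
      case True
      then have "length X < length Y" by (simp add: G_related_def)
      then show ?thesis using G_related_subst_word[OF W X Y] nth_subst_word_length[OF W, of X Y] by simp
    next
      case False
      then show ?thesis using G_related_subst_word[OF W X Y] by simp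
    qed
    show ?thesis
      unfolding 2(1) list.map pair_in_G_iff[OF 2(2)] pair_in_G_iff[OF ne]
        XY[OF 2(3,4), of "\<lambda>A. [0, 1] \<in> rel A R"] XY[OF 2(4,3), of "\<lambda>A. [1, 0] \<in> rel A R"] ..
  qed
qed

theorem theorem4:
  fixes L :: "'l language" and K :: "('v, 'l) rstruct"
    and k :: nat and \<chi> :: "'l word set \<Rightarrow> 'c"
  assumes "finite (symbols L)" and "\<forall>R\<in>symbols L. arity L R \<in> {1, 2}"
    and "is_structure L K" and "countable (verts K)" and "infinite (verts K)"
    and "irreducible_struct L K"
    and "cycle_completion_property L K"
    and "k \<ge> 1"
    and "finite (\<chi> ` {S. S \<subseteq> verts (G L K) \<and> card S = k})"
  shows "\<exists>f. embedding L (G L K) (G L K) f \<and>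
    (\<forall>S. S \<subseteq> f ` verts (G L K) \<and> card S = k \<longrightarrow>
       tau (alphabet L K) S = tau (alphabet L K) (f -` S \<inter> verts (G L K))) \<and>
    (\<forall>S T. S \<subseteq> f ` verts (G L K) \<and> card S = k \<and>
           T \<subseteq> f ` verts (G L K) \<and> card T = k \<and>
           tau (alphabet L K) S = tau (alphabet L K) T \<longrightarrow> \<chi> S = \<chi> T)"
proof -
  have vG: "verts (G L K) = G_verts L K" by (simp add: G_def)
  have sub: "G_verts L K \<subseteq> lists (alphabet L K)" "[] \<notin> G_verts L K" by (auto simp: G_verts_def)
  obtain W where W: "infinite_parameter_word W"
    "\<And>S T. S \<subseteq> G_verts L K \<Longrightarrow> card S = k \<Longrightarrow> T \<subseteq> G_verts L K \<Longrightarrow> card T = k \<Longrightarrow>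
      tau (alphabet L K) S = tau (alphabet L K) T \<Longrightarrow> \<chi> (subst_word W ` S) = \<chi> (subst_word W ` T)"
    by (rule embedding_type_Ramsey[OF finite_alphabet[OF assms(1,2)] sub assms(8)
          assms(9)[unfolded vG] subst_word_G_verts]) blast+
  let ?f = "subst_word W"
  \<comment> \<open>The choice of \<open>W\<close> concerns images of \<open>k\<close>-sets, the
    conclusion concerns \<open>k\<close>-subsets of the image. Injectivity makes the preimage a
    \<open>k\<close>-set again, and substitution does not change its type.\<close>
  define pre where "pre S = ?f -` S \<inter> verts (G L K)" for S
  have pre: "pre S \<subseteq> G_verts L K" "?f ` pre S = S" "card (pre S) = k"
    "tau (alphabet L K) S = tau (alphabet L K) (pre S)"
    if S: "S \<subseteq> ?f ` verts (G L K)" "card S = k" for S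
  proof -
    show p: "pre S \<subseteq> G_verts L K" by (auto simp: pre_def vG)
    show im: "?f ` pre S = S" using S(1) by (auto simp: pre_def)
    have "card (?f ` pre S) = card (pre S)"
      by (rule card_image[OF inj_on_subset[OF inj_subst_word[OF W(1)] subset_UNIV]])
    then show c: "card (pre S) = k" using im S(2) by simp
    then have "finite (pre S)" "pre S \<noteq> {}" using assms(8) by (auto intro: card_ge_0_finite)
    then obtain X where "X \<in> pre S" by blast
    moreover from this have "X \<noteq> []" using p sub(2) by blast
    ultimately have "tau (alphabet L K) (?f ` pre S) = tau (alphabet L K) (pre S)"
      by (rule tau_subst_word[OF W(1) \<open>finite (pre S)\<close> subset_trans[OF p sub(1)]])
    then show "tau (alphabet L K) S = tau (alphabet L K) (pre S)" unfolding im .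
  qed
  show ?thesis
  proof (intro exI[of _ ?f] conjI allI impI)
    show "embedding L (G L K) (G L K) ?f" by (rule embedding_subst_word[OF assms(2,3,5,6,7) W(1)])
  next
    fix S assume "S \<subseteq> ?f ` verts (G L K) \<and> card S = k"
    then show "tau (alphabet L K) S = tau (alphabet L K) (?f -` S \<inter> verts (G L K))"
      using pre(4)[of S] unfolding pre_def by blast
  next
    fix S T assume ST: "S \<subseteq> ?f ` verts (G L K) \<and> card S = k \<and> T \<subseteq> ?f ` verts (G L K) \<and> card T = k \<and>
      tau (alphabet L K) S = tau (alphabet L K) T"
    then have "tau (alphabet L K) (pre S) = tau (alphabet L K) (pre T)" using pre(4)[of S] pre(4)[of T] by simp
    then have "\<chi> (?f ` pre S) = \<chi> (?f ` pre T)" using ST pre(1,3) by (intro W(2)) blast+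
    then show "\<chi> S = \<chi> T" using ST pre(2)[of S] pre(2)[of T] by simp
  qed
qed

end
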